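(* Let $p\ge 3$, $r\ge 3$ and $m\ge 0$ be integers, and let $\mathcal H$ be a unicyclic linear $r$-uniform (simple) hypergraph with $m+p$ edges whose unique cycle has length $p$. Let $k$ be a positive integer. (1) If $p$ is odd, then $P_{DP}(\mathcal H,k)=P(\mathcal H,k)$. (2) If $p$ is even, then $$P_{DP}(\mathcal H,k)=(k^{r-1}-1)^{m+p}+(-1)^{p+1}(k^{r-1}-1)^{m}.$$
   Context: A hypergraph $\mathcal H=(X,E)$ consists of a finite non-empty set $X$ (vertices) and a set $E\subseteq 2^X$ (edges) with $|e|\ge 2$ for every $e\in E$. It is simple if $e_1\not\subseteq e_2$ for any two distinct edges, $r$-uniform if $|e|=r$ for every $e\in E$, and linear if $|e_1\cap e_2|\le 1$ for any two distinct edges. A path is a subhypergraph consisting of edges $e_1,\dots,e_t$ with $e_i\cap e_{i+1}\ne\emptyset$ for $1\le i\le t-1$; $\mathcal H$ is connected if for any two vertices $u$ and $v$ there is a path containing both. A cycle of length $l\ge 3$ is a subhypergraph consisting of $l$ distinct edges $e_1,\dots,e_l$ for which there exist vertices $v_i\in e_i\cap e_{i+1}$ for $1\le i\le l-1$ and $v_l\in e_1\cap e_l$. A unicyclic hypergraph is a connected hypergraph containing exactly one cycle. For a positive integer $k$ write $[k]=\{1,\dots,k\}$. A proper $k$-coloring of $\mathcal H$ is a map $f:X\to[k]$ that is not constant on any edge; $P(\mathcal H,k)$ is the number of proper $k$-colorings. A partial map $\varphi:X\rightharpoonup [k]$ is a function from a subset $\mathrm{dom}(\varphi)\subseteq X$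 to $[k]$; it is identified with its graph $\{(x,\varphi(x)):x\in\mathrm{dom}(\varphi)\}\subseteq X\times[k]$. A $k$-fold cover of $\mathcal H$ is a set $\mathcal F$ of partial maps $X\rightharpoonup[k]$ such that $\mathrm{dom}(\varphi)\in E$ for every $\varphi\in\mathcal F$, and whenever $\varphi\neq\psi$ in $\mathcal F$ have $\mathrm{dom}(\varphi)=\mathrm{dom}(\psi)$, then $\varphi\cap\psi=\emptyset$ (i.e. $\varphi(x)\ne\psi(x)$ for all $x$ in the common domain). An $\mathcal F$-coloring of $\mathcal H$ is a function $f:X\to[k]$ such that $\varphi\not\subseteq f$ for every $\varphi\in\mathcal F$. $P_{DP}(\mathcal H,\mathcal F)$ denotes the number of $\mathcal F$-colorings, and the DP color function $P_{DP}(\mathcal H,k)$ is the minimum of $P_{DP}(\mathcal H,\mathcal F)$ over all $k$-fold covers $\mathcal F$ of $\mathcal H$.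
   Formalization: Part (2) is stated for k ≥ 2 or m ≥ 1: for k = 1, m = 0 the printed formula gives 0^p − 0^0 = −1, which is not a number of colorings. The connecting vertices of a cycle are taken to be distinct, as is standard. *)

theory Defs
  imports Main "HOL-Library.FuncSet"
begin

definition hypergraph :: "'a set \<Rightarrow> 'a set set \<Rightarrow> bool" where
  "hypergraph X E \<longleftrightarrow> finite X \<and> X \<noteq> {} \<and> E \<subseteq> Pow X \<and> (\<forall>e\<in>E. 2 \<le> card e)"

definition simple_hg :: "'a set set \<Rightarrow> bool" where
  "simple_hg E \<longleftrightarrow> (\<forall>e1\<in>E. \<forall>e2\<in>E. e1 \<noteq> e2 \<longrightarrow> \<not> e1 \<subseteq> e2)"

definition uniform_hg :: "nat \<Rightarrow> 'a set set \<Rightarrow> bool" where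
  "uniform_hg r E \<longleftrightarrow> (\<forall>e\<in>E. card e = r)"

definition linear_hg :: "'a set set \<Rightarrow> bool" where
  "linear_hg E \<longleftrightarrow> (\<forall>e1\<in>E. \<forall>e2\<in>E. e1 \<noteq> e2 \<longrightarrow> card (e1 \<inter> e2) \<le> 1)"

definition is_path_hg :: "'a set set \<Rightarrow> 'a set list \<Rightarrow> bool" where
  "is_path_hg E es \<longleftrightarrow> es \<noteq> [] \<and> set es \<subseteq> E \<and>
     (\<forall>i. i + 1 < length es \<longrightarrow> es ! i \<inter> es ! (i + 1) \<noteq> {})"

definition connected_hg :: "'a set \<Rightarrow> 'a set set \<Rightarrow> bool" where
  "connected_hg X E \<longleftrightarrow>
     (\<forall>u\<in>X. \<forall>v\<in>X. u \<noteq> v \<longrightarrow> (\<exists>es. is_path_hg E es \<and> u \<in> \<Union>(set es) \<and> v \<in> \<Union>(set es)))"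

(* A cycle is a subhypergraph, so it is represented by its set C of edges: rotating or
   reversing the enumeration es does not give a different cycle.
   The connecting vertices vs are distinct, as usual for cycles in hypergraphs. If they
   were allowed to coincide, any three edges through a common vertex would form a cycle. *)
definition is_cycle_hg :: "'a set set \<Rightarrow> nat \<Rightarrow> 'a set set \<Rightarrow> bool" where
  "is_cycle_hg E l C \<longleftrightarrow> 3 \<le> l \<and> C \<subseteq> E \<and>
     (\<exists>es vs. length es = l \<and> distinct es \<and> set es = C \<and>
        length vs = l \<and> distinct vs \<and>
        (\<forall>i. i + 1 < l \<longrightarrow> vs ! i \<in> es ! i \<inter> es ! (i + 1)) \<and>
        vs ! (l - 1) \<in> es ! 0 \<inter> es ! (l - 1))"

definition unicyclic_hg :: "'a set \<Rightarrow> 'a set set \<Rightarrow> bool" where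
  "unicyclic_hg X E \<longleftrightarrow> hypergraph X E \<and> connected_hg X E \<and> (\<exists>!C. \<exists>l. is_cycle_hg E l C)"

(* Maps X -> [k] are rendered as extensional functions, so that each is counted once. *)
definition proper_colorings :: "'a set \<Rightarrow> 'a set set \<Rightarrow> nat \<Rightarrow> ('a \<Rightarrow> nat) set" where
  "proper_colorings X E k =
     {f \<in> X \<rightarrow>\<^sub>E {1..k}. \<forall>e\<in>E. \<not> (\<exists>c. \<forall>x\<in>e. f x = c)}"

definition chromatic_count :: "'a set \<Rightarrow> 'a set set \<Rightarrow> nat \<Rightarrow> nat" where
  "chromatic_count X E k = card (proper_colorings X E k)"

definition is_cover :: "'a set set \<Rightarrow> nat \<Rightarrow> ('a \<rightharpoonup> nat) set \<Rightarrow> bool" where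
  "is_cover E k F \<longleftrightarrow>
     (\<forall>\<phi>\<in>F. dom \<phi> \<in> E \<and> ran \<phi> \<subseteq> {1..k}) \<and>
     (\<forall>\<phi>\<in>F. \<forall>\<psi>\<in>F. \<phi> \<noteq> \<psi> \<longrightarrow> dom \<phi> = dom \<psi> \<longrightarrow> Map.graph \<phi> \<inter> Map.graph \<psi> = {})"

definition cover_colorings :: "'a set \<Rightarrow> nat \<Rightarrow> ('a \<rightharpoonup> nat) set \<Rightarrow> ('a \<Rightarrow> nat) set" where
  "cover_colorings X k F =
     {f \<in> X \<rightarrow>\<^sub>E {1..k}. \<forall>\<phi>\<in>F. \<not> Map.graph \<phi> \<subseteq> (\<lambda>x. (x, f x)) ` X}"

definition DP_count :: "'a set \<Rightarrow> 'a set set \<Rightarrow> nat \<Rightarrow> nat" where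
  "DP_count X E k = Min {card (cover_colorings X k F) | F. is_cover E k F}"

(* Min is meaningful here: the set of counts is finite and non-empty. *)
lemma finite_cover_counts:
  assumes "finite X"
  shows "finite {card (cover_colorings X k F) | F. is_cover E k F}"
proof (rule finite_subset)
  have "finite (X \<rightarrow>\<^sub>E {1..k})"
    using assms by (simp add: finite_PiE)
  then show "{card (cover_colorings X k F) | F. is_cover E k F} \<subseteq> {..card (X \<rightarrow>\<^sub>E {1..k})}"
    by (auto simp: cover_colorings_def intro!: card_mono)
qed simp

lemma cover_counts_nonempty: "{card (cover_colorings X k F) | F. is_cover E k F} \<noteq> {}"
proof -
  have "is_cover E k {}"
    by (simp add: is_cover_def)
  then show ?thesis
    by blast
qed

end

theory Submission
  imports Defs
begin

text \<open>
  Enlarging a cover only destroys colorings, and every cover extends to one in which each edge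
  carries exactly \<open>k\<close> maps, that is, to a family of permutations of the colors. For such a cover
  let \<open>N = k ^ (r - 1)\<close>. An edge meeting the part already colored in one vertex multiplies the
  number of colorings by \<open>N - 1\<close>. Along the cycle of length \<open>p\<close> the permutations compose to a
  holonomy, and if it has \<open>q\<close> fixed points then the cycle has
  \<open>(N - 1) ^ p + (- 1) ^ p * (q - 1)\<close> colorings. The remaining \<open>m\<close> edges hang on the cycle
  tree-like. So an odd \<open>p\<close> asks for \<open>q = k\<close>, realized by proper colorings, and an even \<open>p\<close> asks
  for \<open>q = 0\<close>, realized by one cyclic shift.
\<close>

section \<open>Colorings avoiding permutation covers\<close>

text \<open>Both the sign and the role of the fixed points come from one recurrence. Let A(t,
  \<tau>) count the colorings of a path with t edges whose end color is \<tau> applied to the start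
  color. If the end color is fixed before the last edge is imposed, that edge meets the colored
  vertices in two points, so A(t+1, \<tau>) = N (N-1)^t - A(t, \<tau>'), where \<tau>' is \<tau>
  pulled back through the edge. Since A(0, \<tau>) is the number of fixed points of \<tau>,
  unrolling leaves only the number of colors on which the twist and the transport along the path
  agree. The closing edge of the cycle obeys the same recurrence. The structural obstacle is that a
  cycle, as defined, may have edges meeting in further vertices, and edges off the cycle may touch
  it several times. That each edge meets the earlier ones in exactly one vertex has to be extracted
  from uniqueness of the cycle: a second contact would close a cycle among the edges collected so
  far, which is impossible while these do not contain all of C, or when the new edge lies outside
  C.\<close>

text \<open>\<open>\<pi> e x c\<close> is the color given to \<open>x\<close> by the \<open>c\<close>-th map with domain \<open>e\<close>.\<close>

definition pcol :: "nat \<Rightarrow> ('a set \<Rightarrow> 'a \<Rightarrow> nat \<Rightarrow> nat) \<Rightarrow> 'a set \<Rightarrow> 'a set set \<Rightarrow> ('a \<Rightarrow> nat) set" where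
  "pcol k \<pi> V S = {f \<in> V \<rightarrow>\<^sub>E {1..k}. \<forall>e\<in>S. \<not> (\<exists>c\<in>{1..k}. \<forall>x\<in>e. f x = \<pi> e x c)}"

text \<open>Demanded at every pair, so that the notion does not mention the hypergraph and one
  family \<open>\<pi>\<close> serves all of its subfamilies of edges during the growth.\<close>

definition perm_cover :: "nat \<Rightarrow> ('a set \<Rightarrow> 'a \<Rightarrow> nat \<Rightarrow> nat) \<Rightarrow> bool" where
  "perm_cover k \<pi> \<longleftrightarrow> (\<forall>e x. bij_betw (\<pi> e x) {1..k} {1..k})"

lemma perm_cover_in: "perm_cover k \<pi> \<Longrightarrow> c \<in> {1..k} \<Longrightarrow> \<pi> e x c \<in> {1..k}"
  unfolding perm_cover_def by (meson bij_betwE)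

lemma perm_cover_inj:
  "perm_cover k \<pi> \<Longrightarrow> c \<in> {1..k} \<Longrightarrow> d \<in> {1..k} \<Longrightarrow> \<pi> e x c = \<pi> e x d \<Longrightarrow> c = d"
  unfolding perm_cover_def by (meson bij_betw_imp_inj_on inj_onD)

lemma finite_pcol: "finite V \<Longrightarrow> finite (pcol k \<pi> V S)"
  unfolding pcol_def by (rule finite_subset[of _ "V \<rightarrow>\<^sub>E {1..k}"]) (auto intro: finite_PiE)

lemma pcolD: "f \<in> pcol k \<pi> V S \<Longrightarrow> x \<in> V \<Longrightarrow> f x \<in> {1..k}"
  unfolding pcol_def by blast

lemma pcol_constraint_cong:
  assumes "\<forall>e\<in>S. \<not> (\<exists>c\<in>{1..k}. \<forall>x\<in>e. f x = \<pi> e x c)"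
    and "\<And>e. e \<in> S \<Longrightarrow> e \<subseteq> V" and "\<And>x. x \<in> V \<Longrightarrow> f x = g x"
  shows "\<forall>e\<in>S. \<not> (\<exists>c\<in>{1..k}. \<forall>x\<in>e. g x = \<pi> e x c)"
proof (rule ballI, rule notI, elim bexE)
  fix e c assume e: "e \<in> S" and c: "c \<in> {1..k}" and g: "\<forall>x\<in>e. g x = \<pi> e x c"
  have "\<forall>x\<in>e. f x = \<pi> e x c"
    using assms(2)[OF e] assms(3) g by auto
  then show False using assms(1) e c by blast
qed

text \<open>The colors on \<open>e - V\<close> are free, except that no map of \<open>e\<close>
  already agreeing with \<open>f\<close> on \<open>e \<inter> V\<close> may be completed. These
  forbidden completions are pairwise distinct because \<open>e\<close> has a vertex outside
  \<open>V\<close>, where different indices give different colors.\<close>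

lemma card_extensions:
  assumes \<pi>: "perm_cover k \<pi>" and fin: "finite V" "finite e" and S: "\<And>d. d \<in> S \<Longrightarrow> d \<subseteq> V"
    and e: "\<not> e \<subseteq> V" and f: "f \<in> pcol k \<pi> V S"
  shows "int (card {g \<in> pcol k \<pi> (V \<union> e) (insert e S). restrict g V = f})
    = int k ^ card (e - V) - int (card {c \<in> {1..k}. \<forall>x\<in>e \<inter> V. f x = \<pi> e x c})"
proof -
  let ?D = "e - V" and ?B = "{c \<in> {1..k}. \<forall>x\<in>e \<inter> V. f x = \<pi> e x c}"
  let ?ext = "\<lambda>c. \<lambda>x\<in>?D. \<pi> e x c"
  let ?G = "{g \<in> pcol k \<pi> (V \<union> e) (insert e S). restrict g V = f}"
  have fV: "f \<in> V \<rightarrow>\<^sub>E {1..k}" and fS: "\<forall>e\<in>S. \<not> (\<exists>c\<in>{1..k}. \<forall>x\<in>e. f x = \<pi> e x c)"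
    using f by (auto simp: pcol_def)
  have "bij_betw (\<lambda>g. restrict g ?D) ?G ((?D \<rightarrow>\<^sub>E {1..k}) - ?ext ` ?B)"
  proof (rule bij_betw_byWitness[where f' = "\<lambda>h x. if x \<in> V then f x else h x"])
    show "\<forall>g\<in>?G. (\<lambda>x. if x \<in> V then f x else restrict g ?D x) = g"
      by (auto simp: pcol_def fun_eq_iff restrict_def PiE_def extensional_def)
    show "\<forall>h\<in>(?D \<rightarrow>\<^sub>E {1..k}) - ?ext ` ?B. restrict (\<lambda>x. if x \<in> V then f x else h x) ?D = h"
      by (auto simp: fun_eq_iff restrict_def PiE_def extensional_def)
    show "(\<lambda>g. restrict g ?D) ` ?G \<subseteq> (?D \<rightarrow>\<^sub>E {1..k}) - ?ext ` ?B"
    proof clarify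
      fix g assume g: "g \<in> pcol k \<pi> (V \<union> e) (insert e S)" and fg: "f = restrict g V"
      have gV: "g \<in> V \<union> e \<rightarrow>\<^sub>E {1..k}" using g by (simp add: pcol_def)
      have "restrict g ?D \<noteq> ?ext c" if c: "c \<in> ?B" for c
      proof
        assume eq: "restrict g ?D = ?ext c"
        have "g x = \<pi> e x c" if "x \<in> e" for x
          using c fg that fun_cong[OF eq, of x] by (cases "x \<in> V") auto
        then show False using g c by (auto simp: pcol_def)
      qed
      moreover have "restrict g ?D \<in> ?D \<rightarrow>\<^sub>E {1..k}" using gV by auto
      ultimately show "restrict g ?D \<in> (?D \<rightarrow>\<^sub>E {1..k}) - ?ext ` {c \<in> {1..k}. \<forall>x\<in>e \<inter> V. restrict g V x = \<pi> e x c}"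
        using fg by blast
    qed
    show "(\<lambda>h x. if x \<in> V then f x else h x) ` ((?D \<rightarrow>\<^sub>E {1..k}) - ?ext ` ?B) \<subseteq> ?G"
    proof clarify
      fix h assume h: "h \<in> ?D \<rightarrow>\<^sub>E {1..k}" and nb: "h \<notin> ?ext ` ?B"
      let ?g = "\<lambda>x. if x \<in> V then f x else h x"
      have "?g \<in> V \<union> e \<rightarrow>\<^sub>E {1..k}"
        using h fV by (auto simp: PiE_def extensional_def Pi_def)
      moreover have "restrict ?g V = f"
        using fV by (auto simp: fun_eq_iff restrict_def PiE_def extensional_def)
      moreover have "\<forall>e\<in>S. \<not> (\<exists>c\<in>{1..k}. \<forall>x\<in>e. ?g x = \<pi> e x c)"
        using fS by (rule pcol_constraint_cong[OF _ S]) auto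
      moreover have "\<not> (\<exists>c\<in>{1..k}. \<forall>x\<in>e. ?g x = \<pi> e x c)"
      proof
        assume "\<exists>c\<in>{1..k}. \<forall>x\<in>e. ?g x = \<pi> e x c"
        then obtain c where c: "c \<in> {1..k}" "\<forall>x\<in>e. ?g x = \<pi> e x c" by blast
        have "h = ?ext c"
        proof
          fix x show "h x = ?ext c x"
            using h c(2) by (cases "x \<in> ?D") (auto simp: PiE_def extensional_def)
        qed
        moreover have "c \<in> ?B" using c by auto
        ultimately show False using nb by blast
      qed
      ultimately show "?g \<in> pcol k \<pi> (V \<union> e) (insert e S) \<and> restrict ?g V = f"
        by (simp add: pcol_def)
    qed
  qed
  then have "card ?G = card ((?D \<rightarrow>\<^sub>E {1..k}) - ?ext ` ?B)"
    by (rule bij_betw_same_card)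
  also have sub: "?ext ` ?B \<subseteq> ?D \<rightarrow>\<^sub>E {1..k}"
    unfolding image_subset_iff restrict_PiE_iff using perm_cover_in[OF \<pi>] by blast
  have finD: "finite (?D \<rightarrow>\<^sub>E {1..k})" using fin by (auto intro: finite_PiE)
  have "card ((?D \<rightarrow>\<^sub>E {1..k}) - ?ext ` ?B) = card (?D \<rightarrow>\<^sub>E {1..k}) - card (?ext ` ?B)"
    using card_Diff_subset[OF finite_subset[OF sub finD] sub] .
  finally have "int (card ?G) = int (card (?D \<rightarrow>\<^sub>E {1..k})) - int (card (?ext ` ?B))"
    using card_mono[OF finD sub] by (simp only: of_nat_diff)
  also have "card (?ext ` ?B) = card ?B"
  proof (rule card_image, rule inj_onI)
    fix c d assume cd: "c \<in> ?B" "d \<in> ?B" "?ext c = ?ext d"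
    obtain x where "x \<in> ?D" using e by blast
    then have "\<pi> e x c = \<pi> e x d" using fun_cong[OF cd(3), of x] by simp
    then show "c = d" using perm_cover_inj[OF \<pi>] cd by blast
  qed
  also have "card (?D \<rightarrow>\<^sub>E {1..k}) = k ^ card ?D"
    using fin by (simp add: card_PiE)
  finally show ?thesis by (simp only: of_nat_power)
qed

text \<open>Group the colorings by their restriction to \<open>V\<close>. The predicate
  \<open>Q\<close>, which may look only at \<open>V\<close>, is there to carry the relation between
  the two end colors of a path; the plain counts take it to be true.\<close>

lemma card_pcol_insert:
  assumes \<pi>: "perm_cover k \<pi>" and fin: "finite V" "finite e" and S: "\<And>d. d \<in> S \<Longrightarrow> d \<subseteq> V"
    and e: "\<not> e \<subseteq> V"
    and Q: "\<And>f g. (\<And>x. x \<in> V \<Longrightarrow> f x = g x) \<Longrightarrow> Q f = Q g"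
  shows "int (card {g \<in> pcol k \<pi> (V \<union> e) (insert e S). Q g})
    = (\<Sum>f | f \<in> pcol k \<pi> V S \<and> Q f.
        int k ^ card (e - V) - int (card {c \<in> {1..k}. \<forall>x\<in>e \<inter> V. f x = \<pi> e x c}))"
proof -
  let ?G = "{g \<in> pcol k \<pi> (V \<union> e) (insert e S). Q g}" and ?F = "{f. f \<in> pcol k \<pi> V S \<and> Q f}"
  have "finite ?G" "finite ?F"
    using fin by (auto simp: finite_pcol)
  moreover have Qr: "Q (restrict g V) = Q g" for g by (rule Q) simp
  moreover have "restrict g V \<in> pcol k \<pi> V S" if "g \<in> pcol k \<pi> (V \<union> e) (insert e S)" for g
  proof -
    have "\<forall>e\<in>S. \<not> (\<exists>c\<in>{1..k}. \<forall>x\<in>e. restrict g V x = \<pi> e x c)"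
    proof (rule pcol_constraint_cong[OF _ S])
      show "\<forall>e\<in>S. \<not> (\<exists>c\<in>{1..k}. \<forall>x\<in>e. g x = \<pi> e x c)" using that by (simp add: pcol_def)
    qed auto
    moreover have "restrict g V \<in> V \<rightarrow>\<^sub>E {1..k}" using that by (auto simp: pcol_def)
    ultimately show ?thesis by (simp add: pcol_def)
  qed
  ultimately have "(\<Sum>g\<in>?G. 1::int) = (\<Sum>f\<in>?F. \<Sum>g | g \<in> ?G \<and> restrict g V = f. 1)"
    by (subst sum.group) auto
  also have "\<dots> = (\<Sum>f\<in>?F. int (card {g \<in> pcol k \<pi> (V \<union> e) (insert e S). restrict g V = f}))"
  proof (rule sum.cong[OF refl])
    fix f assume "f \<in> ?F"
    then have "{g. g \<in> ?G \<and> restrict g V = f} = {g \<in> pcol k \<pi> (V \<union> e) (insert e S). restrict g V = f}"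
      using Qr by blast
    then show "(\<Sum>g | g \<in> ?G \<and> restrict g V = f. 1) =
      int (card {g \<in> pcol k \<pi> (V \<union> e) (insert e S). restrict g V = f})" by simp
  qed
  also have "\<dots> = (\<Sum>f\<in>?F. int k ^ card (e - V) - int (card {c \<in> {1..k}. \<forall>x\<in>e \<inter> V. f x = \<pi> e x c}))"
    by (rule sum.cong[OF refl], rule card_extensions[OF \<pi> fin S e]) auto
  finally show ?thesis by simp
qed

lemma card_perm_preimage:
  assumes \<pi>: "perm_cover k \<pi>" and y: "y \<in> {1..k}"
  shows "card {c \<in> {1..k}. y = \<pi> e x c} = 1"
proof -
  obtain c where c: "c \<in> {1..k}" "y = \<pi> e x c"
    using \<pi> y unfolding perm_cover_def by (metis bij_betw_imp_surj_on imageE)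
  then have "{c \<in> {1..k}. y = \<pi> e x c} = {c}"
    using perm_cover_inj[OF \<pi>] by blast
  then show ?thesis by simp
qed

lemma card_pcol_pendant:
  assumes \<pi>: "perm_cover k \<pi>" and fin: "finite V" "finite e" and S: "\<And>d. d \<in> S \<Longrightarrow> d \<subseteq> V"
    and w: "e \<inter> V = {w}" and r: "card e = r" "2 \<le> r"
  shows "int (card (pcol k \<pi> (V \<union> e) (insert e S))) = int (card (pcol k \<pi> V S)) * (int k ^ (r - 1) - 1)"
proof -
  have D: "card (e - V) = r - 1"
    using r fin w card_Diff_subset_Int[of e V] by simp
  have e: "\<not> e \<subseteq> V"
  proof
    assume "e \<subseteq> V"
    then have "card (e - V) = 0" by (metis Diff_eq_empty_iff card.empty)
    then show False using D r(2) by simp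
  qed
  have "int (card (pcol k \<pi> (V \<union> e) (insert e S)))
    = (\<Sum>f\<in>pcol k \<pi> V S. int k ^ card (e - V) - int (card {c \<in> {1..k}. \<forall>x\<in>e \<inter> V. f x = \<pi> e x c}))"
    using card_pcol_insert[OF \<pi> fin S e, of S "\<lambda>_. True"] by simp
  also have "\<dots> = (\<Sum>f\<in>pcol k \<pi> V S. int k ^ (r - 1) - 1)"
  proof (rule sum.cong[OF refl])
    fix f assume "f \<in> pcol k \<pi> V S"
    then have "f w \<in> {1..k}" using w by (intro pcolD) auto
    from card_perm_preimage[OF \<pi> this]
    show "int k ^ card (e - V) - int (card {c \<in> {1..k}. \<forall>x\<in>e \<inter> V. f x = \<pi> e x c}) = int k ^ (r - 1) - 1"
      using w D by simp
  qed
  finally show ?thesis by simp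
qed

text \<open>Moves the two permutations of an edge from the twist to the transport, so that both
  sides of the recurrence count the same colors.\<close>

lemma bij_betw_swap_inv_into:
  assumes f: "bij_betw f A A" and g: "bij_betw g A A" and "x \<in> A" "y \<in> A"
  shows "x = f (inv_into A g y) \<longleftrightarrow> g (inv_into A f x) = y"
proof
  assume "x = f (inv_into A g y)"
  then have "inv_into A f x = inv_into A g y"
    using bij_betw_inv_into_left[OF f] bij_betw_apply[OF bij_betw_inv_into[OF g] \<open>y \<in> A\<close>] by simp
  then show "g (inv_into A f x) = y"
    using bij_betw_inv_into_right[OF g \<open>y \<in> A\<close>] by simp
next
  assume "g (inv_into A f x) = y"
  then have "inv_into A g y = inv_into A f x"
    using bij_betw_inv_into_left[OF g] bij_betw_apply[OF bij_betw_inv_into[OF f] \<open>x \<in> A\<close>] by auto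
  then show "x = f (inv_into A g y)"
    using bij_betw_inv_into_right[OF f \<open>x \<in> A\<close>] by simp
qed

text \<open>The color at \<open>x\<close> already determines the index of the map, so the color at
  \<open>x'\<close> merely confirms or refutes it. This is the situation of an edge with two colored
  vertices.\<close>

lemma card_perm_two_constraints:
  assumes \<pi>: "perm_cover k \<pi>" and y: "y \<in> {1..k}"
  shows "card {c \<in> {1..k}. y = \<pi> e x c \<and> z = \<pi> e x' c}
    = of_bool (z = \<pi> e x' (inv_into {1..k} (\<pi> e x) y))"
proof -
  have bij: "bij_betw (\<pi> e x) {1..k} {1..k}" using \<pi> by (simp add: perm_cover_def)
  let ?c = "inv_into {1..k} (\<pi> e x) y"
  have c: "?c \<in> {1..k}" "\<pi> e x ?c = y"
    using bij_betw_apply[OF bij_betw_inv_into[OF bij] y] bij_betw_inv_into_right[OF bij y] by auto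
  have "{c \<in> {1..k}. y = \<pi> e x c \<and> z = \<pi> e x' c} = (if z = \<pi> e x' ?c then {?c} else {})"
  proof -
    have "d = ?c" if "d \<in> {1..k}" "y = \<pi> e x d" for d
      by (rule perm_cover_inj[OF \<pi> that(1) c(1), of e x]) (use that(2) c(2) in simp)
    then show ?thesis using c by auto
  qed
  then show ?thesis by simp
qed

section \<open>Loose paths and the cycle\<close>

text \<open>The vertex set is carried along separately because with no edges
  \<open>\<Union>S\<close> would miss \<open>a\<close>. The last two arguments are the current end
  and the number of edges; the new end \<open>b\<close> may be any vertex of the added edge other
  than the junction \<open>w\<close>.\<close>

inductive loose_path :: "'a \<Rightarrow> nat \<Rightarrow> 'a set \<Rightarrow> 'a set set \<Rightarrow> 'a \<Rightarrow> nat \<Rightarrow> bool" for a r where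
  start: "loose_path a r {a} {} a 0"
| step: "loose_path a r V S w t \<Longrightarrow> finite e \<Longrightarrow> card e = r \<Longrightarrow> e \<inter> V = {w} \<Longrightarrow> b \<in> e \<Longrightarrow> b \<noteq> w
    \<Longrightarrow> loose_path a r (V \<union> e) (insert e S) b (Suc t)"

lemma loose_path_invariants:
  "loose_path a r V S w t \<Longrightarrow> finite V \<and> a \<in> V \<and> w \<in> V \<and> (\<forall>d\<in>S. d \<subseteq> V)"
  by (induction rule: loose_path.induct) auto

lemma card_pcol_loose_path:
  assumes \<pi>: "perm_cover k \<pi>" and r: "2 \<le> r" and "loose_path a r V S w t"
  shows "int (card (pcol k \<pi> V S)) = int k * (int k ^ (r - 1) - 1) ^ t"
  using assms(3)
proof (induction rule: loose_path.induct)
  case start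
  have "pcol k \<pi> {a} {} = {a} \<rightarrow>\<^sub>E {1..k}" by (simp add: pcol_def)
  then show ?case by (simp add: card_PiE)
next
  case (step V S w t e b)
  note inv = loose_path_invariants[OF step.hyps(1)]
  show ?case
    using card_pcol_pendant[OF \<pi> _ step.hyps(2) _ step.hyps(4,3) r, of S] inv step.IH by simp
qed

text \<open>
  \<open>\<rho>\<close> transports colors along the path. The twist \<open>\<tau>\<close> is arbitrary because the induction absorbs
  the permutations of the last edge into it.
\<close>

lemma card_pcol_loose_path_twisted:
  assumes \<pi>: "perm_cover k \<pi>" and r: "3 \<le> r" and "loose_path a r V S w t"
  shows "\<exists>\<rho>. bij_betw \<rho> {1..k} {1..k} \<and>
    (\<forall>\<tau>. bij_betw \<tau> {1..k} {1..k} \<longrightarrow>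
      int (card {f \<in> pcol k \<pi> V S. f w = \<tau> (f a)})
      = (int k ^ (r - 1) - 1) ^ t - (- 1) ^ t + (- 1) ^ t * int (card {i \<in> {1..k}. \<rho> i = \<tau> i})) \<and>
    ((\<forall>e\<in>S. \<forall>x\<in>e. \<forall>c\<in>{1..k}. \<pi> e x c = c) \<longrightarrow> (\<forall>i\<in>{1..k}. \<rho> i = i))"
  using assms(3)
proof (induction rule: loose_path.induct)
  case start
  have "card {f \<in> pcol k \<pi> {a} {}. f a = \<tau> (f a)} = card {i \<in> {1..k}. i = \<tau> i}" for \<tau>
  proof (rule bij_betw_same_card[of "\<lambda>f. f a"], rule bij_betw_byWitness[where f' = "\<lambda>i. \<lambda>x\<in>{a}. i"])
    show "\<forall>f\<in>{f \<in> pcol k \<pi> {a} {}. f a = \<tau> (f a)}. (\<lambda>x\<in>{a}. f a) = f"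
      by (auto simp: pcol_def fun_eq_iff PiE_def extensional_def)
  qed (auto simp: pcol_def split: if_splits)
  then show ?case by (intro exI[of _ id]) (auto simp: bij_betw_def)
next
  case (step V S w t e b)
  let ?K = "{1..k}" and ?N = "int k ^ (r - 1)"
  have finV: "finite V" and aV: "a \<in> V" and wV: "w \<in> V" and SV: "\<And>d. d \<in> S \<Longrightarrow> d \<subseteq> V"
    using loose_path_invariants[OF step.hyps(1)] by auto
  note fine = step.hyps(2)
  have we: "w \<in> e" and bV: "b \<notin> V" using step.hyps(4-6) by auto
  obtain \<rho> where \<rho>: "bij_betw \<rho> ?K ?K"
    and IH: "\<And>\<tau>. bij_betw \<tau> ?K ?K \<Longrightarrow> int (card {f \<in> pcol k \<pi> V S. f w = \<tau> (f a)})
      = (?N - 1) ^ t - (- 1) ^ t + (- 1) ^ t * int (card {i \<in> ?K. \<rho> i = \<tau> i})"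
    and \<rho>_id: "\<forall>e\<in>S. \<forall>x\<in>e. \<forall>c\<in>?K. \<pi> e x c = c \<Longrightarrow> \<forall>i\<in>?K. \<rho> i = i"
    using step.IH by blast
  have bijw: "bij_betw (\<pi> e w) ?K ?K" and bijb: "bij_betw (\<pi> e b) ?K ?K"
    using \<pi> by (auto simp: perm_cover_def)
  let ?wi = "inv_into ?K (\<pi> e w)" and ?bi = "inv_into ?K (\<pi> e b)"
  \<comment> \<open>Transport through \<open>e\<close>: the color at \<open>w\<close> fixes the
    index of a map of \<open>e\<close>, and that map is read off at \<open>b\<close>.\<close>
  define \<rho>' where "\<rho>' = \<pi> e b \<circ> (?wi \<circ> \<rho>)"
  have "bij_betw \<rho>' ?K ?K"
    unfolding \<rho>'_def by (intro bij_betw_trans[OF _ bijb] bij_betw_trans[OF \<rho>] bij_betw_inv_into bijw)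
  moreover have "int (card {g \<in> pcol k \<pi> (V \<union> e) (insert e S). g b = \<tau> (g a)})
      = (?N - 1) ^ Suc t - (- 1) ^ Suc t + (- 1) ^ Suc t * int (card {i \<in> ?K. \<rho>' i = \<tau> i})"
    if \<tau>: "bij_betw \<tau> ?K ?K" for \<tau>
  proof -
    define \<tau>' where "\<tau>' = \<pi> e w \<circ> (?bi \<circ> \<tau>)"
    have \<tau>': "bij_betw \<tau>' ?K ?K"
      unfolding \<tau>'_def by (intro bij_betw_trans[OF _ bijw] bij_betw_trans[OF \<tau>] bij_betw_inv_into bijb)
    \<comment> \<open>The vertex \<open>b\<close> is first added as an isolated vertex with its
      prescribed color \<open>\<tau> (f a)\<close>; only then is \<open>e\<close> imposed. It then
      meets the colored set in \<open>b\<close> and \<open>w\<close>, and the map chosen by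
      \<open>b\<close> agrees at \<open>w\<close> exactly when
      \<open>f w = \<tau>' (f a)\<close>.\<close>
    let ?F = "{f. f \<in> pcol k \<pi> (insert b V) S \<and> f b = \<tau> (f a)}"
    let ?v = "\<lambda>f. int k ^ card (e - insert b V) - int (card {c \<in> ?K. \<forall>x\<in>e \<inter> insert b V. f x = \<pi> e x c})"
    have eV: "e \<inter> insert b V = {b, w}" "V \<union> e = insert b V \<union> e" using step.hyps by auto
    have cardD: "card (e - insert b V) = r - 2"
      using card_Diff_subset_Int[of e "insert b V"] fine eV step.hyps by simp
    \<comment> \<open>Here \<open>r \<ge> 3\<close> enters: besides \<open>b\<close> and
      \<open>w\<close> the edge keeps an uncolored vertex.\<close>
    have ne: "\<not> e \<subseteq> insert b V"
    proof
      assume "e \<subseteq> insert b V"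
      then have "card (e - insert b V) = 0" by (metis Diff_eq_empty_iff card.empty)
      then show False using cardD r by simp
    qed
    have bij: "bij_betw (\<lambda>f. f(b := \<tau> (f a))) (pcol k \<pi> V S) ?F"
    proof (rule bij_betw_byWitness[where f' = "\<lambda>f. restrict f V"])
      show "\<forall>f\<in>pcol k \<pi> V S. restrict (f(b := \<tau> (f a))) V = f"
        using bV by (auto simp: pcol_def fun_eq_iff PiE_def extensional_def)
      show "\<forall>f\<in>?F. (restrict f V)(b := \<tau> (restrict f V a)) = f"
        using bV aV by (auto simp: pcol_def fun_eq_iff PiE_def extensional_def)
      show "(\<lambda>f. f(b := \<tau> (f a))) ` pcol k \<pi> V S \<subseteq> ?F"
      proof (rule image_subsetI)
        fix f assume f: "f \<in> pcol k \<pi> V S"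
        have "f \<in> V \<rightarrow>\<^sub>E ?K" and fS: "\<forall>e\<in>S. \<not> (\<exists>c\<in>?K. \<forall>x\<in>e. f x = \<pi> e x c)"
          using f by (auto simp: pcol_def)
        moreover have "\<tau> (f a) \<in> ?K" using pcolD[OF f aV] \<tau> by (rule bij_betwE[rule_format, rotated])
        ultimately have "f(b := \<tau> (f a)) \<in> insert b V \<rightarrow>\<^sub>E ?K"
          by (simp add: PiE_fun_upd)
        moreover have "\<forall>e\<in>S. \<not> (\<exists>c\<in>?K. \<forall>x\<in>e. (f(b := \<tau> (f a))) x = \<pi> e x c)"
          using fS by (rule pcol_constraint_cong[OF _ SV]) (use bV in auto)
        ultimately have "f(b := \<tau> (f a)) \<in> pcol k \<pi> (insert b V) S" unfolding pcol_def by blast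
        then show "f(b := \<tau> (f a)) \<in> ?F" using aV bV by auto
      qed
      show "(\<lambda>f. restrict f V) ` ?F \<subseteq> pcol k \<pi> V S"
      proof (rule image_subsetI)
        fix f assume f: "f \<in> ?F"
        have fV: "f \<in> insert b V \<rightarrow>\<^sub>E ?K" and fS: "\<forall>e\<in>S. \<not> (\<exists>c\<in>?K. \<forall>x\<in>e. f x = \<pi> e x c)"
          using f by (auto simp: pcol_def)
        have "\<forall>e\<in>S. \<not> (\<exists>c\<in>?K. \<forall>x\<in>e. restrict f V x = \<pi> e x c)"
          using fS by (rule pcol_constraint_cong[OF _ SV]) auto
        moreover have "restrict f V \<in> V \<rightarrow>\<^sub>E ?K"
          unfolding restrict_PiE_iff using fV by blast
        ultimately show "restrict f V \<in> pcol k \<pi> V S" unfolding pcol_def by blast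
      qed
    qed
    have "int (card {g \<in> pcol k \<pi> (insert b V \<union> e) (insert e S). g b = \<tau> (g a)}) = (\<Sum>f\<in>?F. ?v f)"
    proof (rule card_pcol_insert[OF \<pi> _ fine _ ne])
      show "finite (insert b V)" using finV by simp
      show "d \<subseteq> insert b V" if "d \<in> S" for d using SV[OF that] by blast
      show "(f b = \<tau> (f a)) = (g b = \<tau> (g a))" if "\<And>x. x \<in> insert b V \<Longrightarrow> f x = g x" for f g
        using that[of a] that[of b] aV by simp
    qed
    also have "\<dots> = (\<Sum>f\<in>pcol k \<pi> V S. ?v (f(b := \<tau> (f a))))"
      by (rule sum.reindex_bij_betw[OF bij, symmetric])
    also have "\<dots> = (\<Sum>f\<in>pcol k \<pi> V S. int k ^ (r - 2) - of_bool (f w = \<tau>' (f a)))"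
    proof (rule sum.cong[OF refl])
      fix f assume f: "f \<in> pcol k \<pi> V S"
      have y: "\<tau> (f a) \<in> ?K" using pcolD[OF f aV] \<tau> by (rule bij_betwE[rule_format, rotated])
      have "{c \<in> ?K. \<forall>x\<in>e \<inter> insert b V. (f(b := \<tau> (f a))) x = \<pi> e x c}
        = {c \<in> ?K. \<tau> (f a) = \<pi> e b c \<and> f w = \<pi> e w c}"
        using eV(1) step.hyps(6) by auto
      then show "?v (f(b := \<tau> (f a))) = int k ^ (r - 2) - of_bool (f w = \<tau>' (f a))"
        using card_perm_two_constraints[OF \<pi> y, of e b "f w" w] cardD by (simp add: \<tau>'_def)
    qed
    \<comment> \<open>The recurrence: all colorings of the shorter path contribute k^(r-2), and
      those satisfying the pulled-back twist lose one. With the plain path count, the first term is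
      N (N-1)^t.\<close>
    also have "\<dots> = int k ^ (r - 2) * int (card (pcol k \<pi> V S)) - int (card {f \<in> pcol k \<pi> V S. f w = \<tau>' (f a)})"
      using finite_pcol[OF finV] by (simp add: sum_subtractf of_bool_def sum.If_cases Int_def)
    also have "int (card (pcol k \<pi> V S)) = int k * (?N - 1) ^ t"
      using card_pcol_loose_path[OF \<pi> _ step.hyps(1)] r by simp
    also have "int k ^ (r - 2) * (int k * (?N - 1) ^ t) = ?N * (?N - 1) ^ t"
    proof -
      have "r - 1 = Suc (r - 2)" using r by simp
      then show ?thesis by simp
    qed
    also note IH[OF \<tau>']
    also have "{i \<in> ?K. \<rho> i = \<tau>' i} = {i \<in> ?K. \<rho>' i = \<tau> i}"
    proof -
      have "\<rho> i = \<tau>' i \<longleftrightarrow> \<rho>' i = \<tau> i" if i: "i \<in> ?K" for i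
      proof -
        have *: "\<rho> i \<in> ?K" "\<tau> i \<in> ?K" using \<rho> \<tau> i by (auto dest: bij_betwE)
        show ?thesis
          unfolding \<tau>'_def \<rho>'_def comp_def by (rule bij_betw_swap_inv_into[OF bijw bijb *])
      qed
      then show ?thesis by blast
    qed
    finally show ?thesis unfolding eV(2) by (simp add: algebra_simps)
  qed
  moreover have "\<forall>i\<in>?K. \<rho>' i = i" if id: "\<forall>d\<in>insert e S. \<forall>x\<in>d. \<forall>c\<in>?K. \<pi> d x c = c"
  proof
    fix i assume i: "i \<in> ?K"
    have "\<rho> i = i" using \<rho>_id id i by blast
    moreover have "?wi i = i"
      using bij_betw_inv_into_left[OF bijw i] id we i by simp
    ultimately show "\<rho>' i = i" using id step.hyps(5) i by (simp add: \<rho>'_def)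
  qed
  ultimately show ?case by blast
qed

text \<open>The closing edge meets the path in its two ends and forbids one extension for every
  coloring with \<open>f b = \<tau> (f a)\<close>, where \<tau> is its own transport from
  \<open>a\<close> to \<open>b\<close>; so \<open>q\<close> counts the colors on which path and
  closing edge transport alike. The last two clauses record the covers that attain the extreme
  values of \<open>q\<close>.\<close>

lemma card_pcol_cycle:
  assumes \<pi>: "perm_cover k \<pi>" and r: "3 \<le> r" and path: "loose_path a r V S b t"
    and e: "finite e" "card e = r" "e \<inter> V = {a, b}" "a \<noteq> b"
  shows "\<exists>q\<le>k. int (card (pcol k \<pi> (V \<union> e) (insert e S)))
        = (int k ^ (r - 1) - 1) ^ Suc t + (- 1) ^ Suc t * (int q - 1) \<and>
      ((\<forall>d\<in>insert e S. \<forall>x\<in>d. \<forall>c\<in>{1..k}. \<pi> d x c = c) \<longrightarrow> q = k) \<and>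
      ((\<forall>d\<in>S. \<forall>x\<in>d. \<forall>c\<in>{1..k}. \<pi> d x c = c) \<and> (\<forall>c\<in>{1..k}. \<pi> e a c = c \<and> \<pi> e b c \<noteq> c)
        \<longrightarrow> q = 0)"
proof -
  let ?K = "{1..k}" and ?N = "int k ^ (r - 1)"
  have finV: "finite V" and aV: "a \<in> V" and bV: "b \<in> V" and SV: "\<And>d. d \<in> S \<Longrightarrow> d \<subseteq> V"
    using loose_path_invariants[OF path] by auto
  obtain \<rho> where
    twisted: "\<And>\<tau>. bij_betw \<tau> ?K ?K \<Longrightarrow> int (card {f \<in> pcol k \<pi> V S. f b = \<tau> (f a)})
      = (?N - 1) ^ t - (- 1) ^ t + (- 1) ^ t * int (card {i \<in> ?K. \<rho> i = \<tau> i})"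
    and \<rho>_id: "\<forall>e\<in>S. \<forall>x\<in>e. \<forall>c\<in>?K. \<pi> e x c = c \<Longrightarrow> \<forall>i\<in>?K. \<rho> i = i"
    using card_pcol_loose_path_twisted[OF \<pi> r path] by blast
  have bija: "bij_betw (\<pi> e a) ?K ?K" and bijb: "bij_betw (\<pi> e b) ?K ?K"
    using \<pi> by (auto simp: perm_cover_def)
  let ?ai = "inv_into ?K (\<pi> e a)"
  define \<tau> where "\<tau> = \<pi> e b \<circ> ?ai"
  have \<tau>: "bij_betw \<tau> ?K ?K"
    unfolding \<tau>_def by (intro bij_betw_trans[OF _ bijb] bij_betw_inv_into bija)
  define q where "q = card {i \<in> ?K. \<rho> i = \<tau> i}"
  have cardD: "card (e - V) = r - 2"
    using card_Diff_subset_Int[of e V] e by simp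
  have ne: "\<not> e \<subseteq> V"
  proof
    assume "e \<subseteq> V"
    then have "card (e - V) = 0" by (metis Diff_eq_empty_iff card.empty)
    then show False using cardD r by simp
  qed
  have "int (card (pcol k \<pi> (V \<union> e) (insert e S)))
    = (\<Sum>f\<in>pcol k \<pi> V S. int k ^ card (e - V) - int (card {c \<in> ?K. \<forall>x\<in>e \<inter> V. f x = \<pi> e x c}))"
    using card_pcol_insert[OF \<pi> finV e(1) SV ne, where Q = "\<lambda>_. True"] by simp
  also have "\<dots> = (\<Sum>f\<in>pcol k \<pi> V S. int k ^ (r - 2) - of_bool (f b = \<tau> (f a)))"
  proof (rule sum.cong[OF refl])
    fix f assume f: "f \<in> pcol k \<pi> V S"
    have "{c \<in> ?K. \<forall>x\<in>e \<inter> V. f x = \<pi> e x c} = {c \<in> ?K. f a = \<pi> e a c \<and> f b = \<pi> e b c}"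
      using e(3) by auto
    then show "int k ^ card (e - V) - int (card {c \<in> ?K. \<forall>x\<in>e \<inter> V. f x = \<pi> e x c})
      = int k ^ (r - 2) - of_bool (f b = \<tau> (f a))"
      using card_perm_two_constraints[OF \<pi> pcolD[OF f aV], of e a "f b" b] cardD by (simp add: \<tau>_def)
  qed
  also have "\<dots> = int k ^ (r - 2) * int (card (pcol k \<pi> V S)) - int (card {f \<in> pcol k \<pi> V S. f b = \<tau> (f a)})"
    using finite_pcol[OF finV] by (simp add: sum_subtractf of_bool_def sum.If_cases Int_def)
  also have "int (card (pcol k \<pi> V S)) = int k * (?N - 1) ^ t"
    using card_pcol_loose_path[OF \<pi> _ path] r by simp
  also have "int k ^ (r - 2) * (int k * (?N - 1) ^ t) = ?N * (?N - 1) ^ t"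
  proof -
    have "r - 1 = Suc (r - 2)" using r by simp
    then show ?thesis by simp
  qed
  also note twisted[OF \<tau>, folded q_def]
  finally have "int (card (pcol k \<pi> (V \<union> e) (insert e S)))
        = (?N - 1) ^ Suc t + (- 1) ^ Suc t * (int q - 1)"
    by (simp add: algebra_simps)
  moreover have "q \<le> k"
  proof -
    have "card {i \<in> ?K. \<rho> i = \<tau> i} \<le> card ?K" by (rule card_mono) auto
    then show ?thesis by (simp add: q_def)
  qed
  moreover have ai: "?ai i = i" if "\<forall>c\<in>?K. \<pi> e a c = c" "i \<in> ?K" for i
    using bij_betw_inv_into_left[OF bija that(2)] that by simp
  have "q = k" if id: "\<forall>d\<in>insert e S. \<forall>x\<in>d. \<forall>c\<in>?K. \<pi> d x c = c"
  proof -
    have "a \<in> e" "b \<in> e" using e(3) by auto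
    then have "\<forall>c\<in>?K. \<pi> e a c = c" "\<forall>c\<in>?K. \<pi> e b c = c" "\<forall>i\<in>?K. \<rho> i = i"
      using id \<rho>_id by blast+
    then have "{i \<in> ?K. \<rho> i = \<tau> i} = ?K" using ai by (auto simp: \<tau>_def)
    then show ?thesis by (simp add: q_def)
  qed
  moreover have "q = 0" if id: "\<forall>d\<in>S. \<forall>x\<in>d. \<forall>c\<in>?K. \<pi> d x c = c" and shift: "\<forall>c\<in>?K. \<pi> e a c = c \<and> \<pi> e b c \<noteq> c"
  proof -
    have "\<forall>i\<in>?K. \<rho> i = i" using \<rho>_id id by blast
    then have "{i \<in> ?K. \<rho> i = \<tau> i} = {}" using ai shift by (fastforce simp: \<tau>_def)
    then show ?thesis by (simp only: q_def card.empty)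
  qed
  ultimately show ?thesis by blast
qed

section \<open>Structure of unicyclic linear hypergraphs\<close>

definition linked :: "'a set set \<Rightarrow> ('a \<times> 'a) set" where
  "linked S = {(u, v). \<exists>f\<in>S. u \<in> f \<and> v \<in> f}"

text \<open>Connectivity for families of edges still being assembled: only covered vertices are
  compared, and the empty family qualifies. The closure of a relation gives access to shortest walks
  through relation powers.\<close>

definition edge_connected :: "'a set set \<Rightarrow> bool" where
  "edge_connected S \<longleftrightarrow> (\<forall>u\<in>\<Union>S. \<forall>v\<in>\<Union>S. (u, v) \<in> (linked S)\<^sup>*)"

lemma edge_connected_singleton: "edge_connected {e}"
  by (auto simp: edge_connected_def linked_def)

lemma edge_connected_insert:
  assumes S: "edge_connected S" and w: "w \<in> e" "w \<in> \<Union>S"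
  shows "edge_connected (insert e S)"
proof -
  have mono: "(linked S)\<^sup>* \<subseteq> (linked (insert e S))\<^sup>*"
    by (rule rtrancl_mono) (auto simp: linked_def)
  have to: "(u, w) \<in> (linked (insert e S))\<^sup>*" and fro: "(w, u) \<in> (linked (insert e S))\<^sup>*"
    if "u \<in> \<Union>(insert e S)" for u
  proof -
    have "(u, w) \<in> (linked (insert e S))\<^sup>* \<and> (w, u) \<in> (linked (insert e S))\<^sup>*"
    proof (cases "u \<in> e")
      case True
      then show ?thesis using w(1) by (auto simp: linked_def)
    next
      case False
      then have "u \<in> \<Union>S" using that by simp
      then have "(u, w) \<in> (linked S)\<^sup>*" "(w, u) \<in> (linked S)\<^sup>*"
        using S w(2) unfolding edge_connected_def by blast+
      then show ?thesis using mono by blast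
    qed
    then show "(u, w) \<in> (linked (insert e S))\<^sup>*" "(w, u) \<in> (linked (insert e S))\<^sup>*" by auto
  qed
  show ?thesis
    unfolding edge_connected_def using rtrancl_trans[OF to fro] by blast
qed

text \<open>A shortest walk from \<open>u\<close> to \<open>v\<close> in \<open>S\<close> has distinct vertices and edges, and \<open>e\<close> closes it.\<close>

lemma cycle_through_edge:
  assumes lin: "linear_hg E" and fin: "\<And>d. d \<in> E \<Longrightarrow> finite d"
    and S: "S \<subseteq> E" and e: "e \<in> E" "e \<notin> S" and conn: "edge_connected S"
    and u: "u \<in> e" "u \<in> \<Union>S" and v: "v \<in> e" "v \<in> \<Union>S" and uv: "u \<noteq> v"
  shows "\<exists>C l. is_cycle_hg E l C \<and> e \<in> C \<and> C \<subseteq> insert e S"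
proof -
  let ?R = "linked S"
  have "(u, v) \<in> ?R\<^sup>*" using conn u v by (auto simp: edge_connected_def)
  then have ex: "\<exists>n. (u, v) \<in> ?R ^^ n" by (simp add: rtrancl_power)
  define n where "n = (LEAST n. (u, v) \<in> ?R ^^ n)"
  have n: "(u, v) \<in> ?R ^^ n" unfolding n_def by (rule LeastI_ex[OF ex])
  have n_min: "n \<le> l" if "(u, v) \<in> ?R ^^ l" for l
    unfolding n_def using that by (rule Least_le)
  obtain g where g: "g 0 = u" "g n = v" and gR: "\<And>i. i < n \<Longrightarrow> (g i, g (Suc i)) \<in> ?R"
    using n by (auto simp: relpow_fun_conv)
  have seg: "i \<le> j \<Longrightarrow> j \<le> n \<Longrightarrow> (g i, g j) \<in> ?R ^^ (j - i)" for i j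
    by (subst relpow_fun_conv) (auto intro!: exI[of _ "\<lambda>l. g (i + l)"] gR)
  \<comment> \<open>Otherwise the walk could be shortened between \<open>g i\<close> and
    \<open>g j\<close>. Taking \<open>l = 0\<close> makes the vertices distinct, taking
    \<open>l = 1\<close> the edges.\<close>
  have shortcut: "j \<le> i + l" if "i \<le> j" "j \<le> n" "(g i, g j) \<in> ?R ^^ l" for i j l
  proof -
    have "(g 0, g j) \<in> ?R ^^ (i + l)"
      using seg[of 0 i] that by (auto simp: relpow_add)
    moreover have "(g j, g n) \<in> ?R ^^ (n - j)" using seg that by simp
    ultimately have "(u, v) \<in> ?R ^^ (i + l + (n - j))"
      using g by (auto simp: relpow_add)
    from n_min[OF this] show ?thesis using that by simp
  qed
  have "\<exists>f\<in>S. g i \<in> f \<and> g (Suc i) \<in> f" if "i < n" for i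
    using gR[OF that] by (auto simp: linked_def)
  then obtain f where fS: "\<And>i. i < n \<Longrightarrow> f i \<in> S" and f0: "\<And>i. i < n \<Longrightarrow> g i \<in> f i"
    and f1: "\<And>i. i < n \<Longrightarrow> g (Suc i) \<in> f i" by metis
  have g_inj: "i = j" if "i \<le> j" "j \<le> n" "g i = g j" for i j
    using shortcut[of i j 0] that by simp
  have f_inj: "i = j" if "i \<le> j" "j < n" "f i = f j" for i j
  proof -
    have "(g i, g (Suc j)) \<in> ?R ^^ 1"
      using f0[of i] f1[of j] fS[of i] that by (auto simp: linked_def)
    from shortcut[OF _ _ this] that show ?thesis by simp
  qed
  \<comment> \<open>A walk with a single edge would give an edge of \<open>S\<close> sharing both
    \<open>u\<close> and \<open>v\<close> with \<open>e\<close>, against linearity.\<close>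
  have "2 \<le> n"
  proof (rule ccontr)
    assume "\<not> 2 \<le> n"
    moreover have "n \<noteq> 0" using g uv by metis
    ultimately have n1: "n = 1" by simp
    have d: "f 0 \<in> S" "u \<in> f 0" "v \<in> f 0" using fS[of 0] f0[of 0] f1[of 0] g n1 by auto
    then have "card (e \<inter> f 0) \<le> 1" using lin e S unfolding linear_hg_def by (metis subsetD)
    moreover have "card {u, v} \<le> card (e \<inter> f 0)" by (rule card_mono) (use fin e d u v in auto)
    ultimately show False using uv by simp
  qed
  define es where "es = map f [0..<n] @ [e]"
  \<comment> \<open>The walk supplies the junctions g 1, ..., g n, the last of them \<open>v\<close>
    on \<open>e\<close>; the start \<open>u\<close> comes last because it joins \<open>e\<close> to
    the first edge.\<close>
  define vs where "vs = map (\<lambda>i. g (Suc i)) [0..<n] @ [u]"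
  have es_nth: "es ! i = (if i < n then f i else e)" if "i \<le> n" for i
    using that by (auto simp: es_def nth_append)
  have vs_nth: "vs ! i = (if i < n then g (Suc i) else u)" if "i \<le> n" for i
    using that by (auto simp: vs_def nth_append)
  have "is_cycle_hg E (Suc n) (set es)"
    unfolding is_cycle_hg_def
  proof (intro conjI exI)
    show "3 \<le> Suc n" using \<open>2 \<le> n\<close> by simp
    show "set es \<subseteq> E" using fS S e by (auto simp: es_def)
    show "distinct es"
    proof -
      have "inj_on f {0..<n}"
        by (rule inj_onI) (metis atLeastLessThan_iff f_inj nle_le)
      moreover have "e \<notin> f ` {0..<n}" using fS e by auto
      ultimately show ?thesis by (simp add: es_def distinct_map)
    qed
    show "distinct vs"
    proof -
      have "inj_on (\<lambda>i. g (Suc i)) {0..<n}"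
        by (rule inj_onI) (metis Suc_inject Suc_leI Suc_le_mono atLeastLessThan_iff g_inj nle_le)
      moreover have "u \<notin> (\<lambda>i. g (Suc i)) ` {0..<n}"
      proof
        assume "u \<in> (\<lambda>i. g (Suc i)) ` {0..<n}"
        then obtain i where "i < n" "u = g (Suc i)" by auto
        then show False using g_inj[of 0 "Suc i"] g by simp
      qed
      ultimately show ?thesis by (simp add: vs_def distinct_map)
    qed
    show "\<forall>i. i + 1 < Suc n \<longrightarrow> vs ! i \<in> es ! i \<inter> es ! (i + 1)"
    proof (intro allI impI)
      fix i assume i: "i + 1 < Suc n"
      show "vs ! i \<in> es ! i \<inter> es ! (i + 1)"
      proof (cases "Suc i = n")
        case True
        then show ?thesis using i f1[of i] g v by (simp add: es_nth vs_nth)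
      next
        case False
        then show ?thesis using i f1[of i] f0[of "Suc i"] by (simp add: es_nth vs_nth)
      qed
    qed
    show "vs ! (Suc n - 1) \<in> es ! 0 \<inter> es ! (Suc n - 1)"
      using \<open>2 \<le> n\<close> f0[of 0] g u by (simp add: es_nth vs_nth)
  qed (auto simp: es_def vs_def)
  moreover have "e \<in> set es" "set es \<subseteq> insert e S" using fS by (auto simp: es_def)
  ultimately show ?thesis by blast
qed

text \<open>A second contact vertex would close a cycle through \<open>e\<close> inside
  \<open>insert e S\<close>, and this cycle would have to be \<open>C\<close>. Hypothesis
  \<open>C\<close> excludes that in the two ways used later: \<open>e\<close> lies off the cycle, or
  some edge of the cycle has not been collected.\<close>

lemma unique_attachment:
  assumes lin: "linear_hg E" and fin: "\<And>d. d \<in> E \<Longrightarrow> finite d"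
    and uniq: "\<And>D l. is_cycle_hg E l D \<Longrightarrow> D = C"
    and S: "S \<subseteq> E" and e: "e \<in> E" "e \<notin> S" and conn: "edge_connected S"
    and C: "e \<in> C \<Longrightarrow> \<not> C \<subseteq> insert e S" and w: "w \<in> e" "w \<in> \<Union>S"
  shows "e \<inter> \<Union>S = {w}"
proof (rule ccontr)
  assume "e \<inter> \<Union>S \<noteq> {w}"
  then obtain v where "v \<in> e" "v \<in> \<Union>S" "w \<noteq> v" using w by blast
  from cycle_through_edge[OF lin fin S e conn w this] show False using uniq C by blast
qed

text \<open>The cycle is cut open at its last edge. Every proper initial segment omits an edge of
  \<open>C\<close>, so its edges attach at single vertices and form a loose path, which the last
  edge closes.\<close>

lemma cycle_decomposition:
  assumes lin: "linear_hg E" and fin: "\<And>d. d \<in> E \<Longrightarrow> finite d" and unif: "uniform_hg r E"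
    and uniq: "\<And>D l. is_cycle_hg E l D \<Longrightarrow> D = C" and cyc: "is_cycle_hg E p C"
  obtains S e a b where "loose_path a r (\<Union>S) S b (p - 1)" "C = insert e S" "e \<notin> S"
    "e \<inter> \<Union>S = {a, b}" "a \<noteq> b" "edge_connected C"
proof -
  obtain es vs where p3: "3 \<le> p" and CE: "C \<subseteq> E" and es: "length es = p" "distinct es" "set es = C"
    and vs: "length vs = p" "distinct vs" and v: "\<And>i. i + 1 < p \<Longrightarrow> vs ! i \<in> es ! i \<inter> es ! (i + 1)"
    and v0: "vs ! (p - 1) \<in> es ! 0 \<inter> es ! (p - 1)"
    using cyc unfolding is_cycle_hg_def by blast
  define S where "S t = set (take t es)" for t
  \<comment> \<open>\<open>w t\<close> is the vertex at which the edge \<open>es ! t\<close> is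
    attached. The path starts at the vertex shared by the first and the last edge, whence the index
    \<open>p - 1\<close> for \<open>t = 0\<close>.\<close>
  define w where "w t = vs ! (if t = 0 then p - 1 else t - 1)" for t
  let ?a = "vs ! (p - 1)" and ?b = "vs ! (p - 2)"
  have SC: "S t \<subseteq> C" for t using es set_take_subset[of t es] by (auto simp: S_def)
  have esE: "es ! i \<in> E" if "i < p" for i using that es CE nth_mem by blast
  have S_iff: "es ! i \<in> S t \<longleftrightarrow> i < t" if "i < p" for i t
    using that es by (auto simp: S_def in_set_conv_nth nth_eq_iff_index_eq)
  have S_Suc: "S (Suc t) = insert (es ! t) (S t)" if "t < p" for t
    using that es by (simp add: S_def take_Suc_conv_app_nth)
  have conn: "edge_connected (S t) \<and> (t \<noteq> 0 \<longrightarrow> w t \<in> \<Union>(S t))" if "t \<le> p" for t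
    using that
  proof (induction t)
    case 0
    then show ?case by (simp add: S_def edge_connected_def)
  next
    case (Suc t)
    have "w (Suc t) \<in> es ! t"
      using v[of t] v0 Suc.prems by (cases "Suc t = p") (auto simp: w_def)
    moreover have "edge_connected (S (Suc t))"
    proof (cases "t = 0")
      case True
      then have "S (Suc t) = {es ! 0}" using S_Suc[of 0] p3 by (simp add: S_def)
      then show ?thesis by (simp add: edge_connected_singleton)
    next
      case False
      have "w t \<in> es ! t" using v[of "t - 1"] False Suc.prems by (simp add: w_def)
      then show ?thesis using Suc False S_Suc[of t] by (auto intro: edge_connected_insert)
    qed
    ultimately show ?case using S_Suc[of t] Suc.prems by auto
  qed
  \<comment> \<open>For \<open>t = 0\<close> the path is the single vertex \<open>?a\<close>, which
    no collected edge covers yet.\<close>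
  have path: "loose_path ?a r (insert ?a (\<Union>(S t))) (S t) (w t) t" if "t \<le> p - 1" for t
    using that
  proof (induction t)
    case 0
    then show ?case using loose_path.start[of ?a r] by (simp add: S_def w_def)
  next
    case (Suc t)
    have t: "t < p - 1" and tp: "t < p" "Suc t < p" using Suc.prems by auto
    have "es ! t \<inter> insert ?a (\<Union>(S t)) = {w t}"
    proof (cases "t = 0")
      case True
      then show ?thesis using v0 by (auto simp: S_def w_def)
    next
      case False
      have "es ! 0 \<in> S t" using S_iff[of 0 t] False p3 by simp
      then have "?a \<in> \<Union>(S t)" using v0 by blast
      moreover have "es ! t \<inter> \<Union>(S t) = {w t}"
      proof (rule unique_attachment[OF lin fin uniq])
        show "S t \<subseteq> E" using SC CE by blast
        show "es ! t \<in> E" using esE tp by simp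
        show "es ! t \<notin> S t" using S_iff tp by simp
        show "edge_connected (S t)" "w t \<in> \<Union>(S t)" using conn[of t] False tp by auto
        show "w t \<in> es ! t" using v[of "t - 1"] False tp by (simp add: w_def)
        \<comment> \<open>The last edge of the cycle is still absent, so no cycle can have been
          closed.\<close>
        have "es ! (p - 1) \<notin> S (Suc t)" using S_iff[of "p - 1" "Suc t"] t by simp
        moreover have "es ! (p - 1) \<in> C" using es p3 nth_mem[of "p - 1" es] by simp
        ultimately show "\<not> C \<subseteq> insert (es ! t) (S t)" using S_Suc[of t] tp by blast
      qed
      ultimately show ?thesis by (simp add: insert_absorb)
    qed
    moreover have "vs ! t \<in> es ! t" using v[of t] tp by simp
    moreover have "vs ! t \<noteq> w t"
      using vs tp p3 by (auto simp: w_def nth_eq_iff_index_eq)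
    moreover have "finite (es ! t)" "card (es ! t) = r"
      using esE[of t] tp fin unif by (auto simp: uniform_hg_def)
    ultimately have "loose_path ?a r (insert ?a (\<Union>(S t)) \<union> es ! t) (insert (es ! t) (S t)) (vs ! t) (Suc t)"
      using Suc.IH t by (intro loose_path.step) auto
    moreover have "insert ?a (\<Union>(S t)) \<union> es ! t = insert ?a (\<Union>(S (Suc t)))"
      using S_Suc[of t] tp by auto
    ultimately show ?case using S_Suc[of t] tp by (simp add: w_def)
  qed
  let ?S = "S (p - 1)" and ?e = "es ! (p - 1)"
  have "es ! 0 \<in> S (p - 2)" using S_iff[of 0 "p - 2"] p3 by simp
  then have a2: "?a \<in> \<Union>(S (p - 2))" using v0 by blast
  have pp: "Suc (p - 2) = p - 1" "Suc (p - 1) = p" using p3 by auto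
  have S1: "?S = insert (es ! (p - 2)) (S (p - 2))" using S_Suc[of "p - 2"] pp p3 by simp
  have C: "C = insert ?e ?S" using S_Suc[of "p - 1"] pp es by (simp add: S_def)
  have b: "?b \<in> es ! (p - 2)" "?b \<in> ?e" using v[of "p - 2"] pp p3 by auto
  have eS: "?e \<notin> ?S" using S_iff[of "p - 1" "p - 1"] p3 by simp
  show ?thesis
  proof
    show "loose_path ?a r (\<Union>?S) ?S ?b (p - 1)"
    proof -
      have "insert ?a (\<Union>?S) = \<Union>?S" using a2 S1 by auto
      moreover have "w (p - 1) = ?b" using p3 by (auto simp: w_def numeral_2_eq_2)
      ultimately show ?thesis using path[of "p - 1"] by simp
    qed
    show "?a \<noteq> ?b" using vs p3 by (auto simp: nth_eq_iff_index_eq)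
    show "edge_connected C" using conn[of p] es by (simp add: S_def)
    \<comment> \<open>Adding \<open>?e\<close> to all of \<open>?S\<close> does complete the cycle,
      so the contact is computed in two pieces: with \<open>es ! (p - 2)\<close> left out there is
      only \<open>?a\<close>, and linearity leaves only \<open>?b\<close> on that omitted
      edge.\<close>
    have "?e \<inter> \<Union>(S (p - 2)) = {?a}"
    proof (rule unique_attachment[OF lin fin uniq])
      show "S (p - 2) \<subseteq> E" using SC CE by blast
      show "?e \<in> E" using esE p3 by simp
      show "?e \<notin> S (p - 2)" using S_iff[of "p - 1" "p - 2"] p3 by simp
      show "edge_connected (S (p - 2))" using conn[of "p - 2"] by simp
      show "?a \<in> ?e" using v0 by simp
      show "?a \<in> \<Union>(S (p - 2))" by (rule a2)
      have "es ! (p - 2) \<notin> S (p - 2)" using S_iff[of "p - 2" "p - 2"] p3 by simp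
      moreover have "es ! (p - 2) \<noteq> ?e" using es p3 by (simp add: nth_eq_iff_index_eq)
      moreover have "es ! (p - 2) \<in> C" using es p3 nth_mem[of "p - 2" es] by simp
      ultimately show "\<not> C \<subseteq> insert ?e (S (p - 2))" by blast
    qed
    moreover have "?e \<inter> es ! (p - 2) = {?b}"
    proof -
      have "es ! (p - 2) \<noteq> ?e" using es p3 by (simp add: nth_eq_iff_index_eq)
      then have "card (?e \<inter> es ! (p - 2)) \<le> Suc 0"
        using lin esE[of "p - 1"] esE[of "p - 2"] p3 unfolding linear_hg_def by auto
      moreover have "finite (?e \<inter> es ! (p - 2))" using fin esE[of "p - 1"] p3 by simp
      ultimately show ?thesis using b unfolding card_le_Suc0_iff_eq[OF \<open>finite (?e \<inter> es ! (p - 2))\<close>] by blast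
    qed
    ultimately show "?e \<inter> \<Union>?S = {?a, ?b}" using S1 by (auto simp: Int_Un_distrib)
  qed (fact C eS)+
qed

section \<open>Growing the whole hypergraph from its cycle\<close>

lemma exists_adjacent_edge:
  assumes H: "hypergraph X E" and conn: "connected_hg X E" and S: "S \<subset> E" "S \<noteq> {}"
  shows "\<exists>e\<in>E - S. e \<inter> \<Union>S \<noteq> {}"
proof (rule ccontr)
  assume "\<not> ?thesis"
  then have sep: "e \<inter> \<Union>S = {}" if "e \<in> E" "e \<notin> S" for e using that by blast
  have nonempty: "d \<noteq> {}" "d \<subseteq> X" if "d \<in> E" for d using H that by (auto simp: hypergraph_def)
  obtain d e where d: "d \<in> S" and e: "e \<in> E" "e \<notin> S" using S by blast
  have dE: "d \<in> E" using d S by blast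
  obtain u where u: "u \<in> d" using nonempty(1)[OF dE] by blast
  obtain v where v: "v \<in> e" using nonempty(1)[OF e(1)] by blast
  have vS: "v \<notin> \<Union>S" using sep[OF e] v by blast
  then have "u \<noteq> v" using u d by blast
  moreover have "u \<in> X" "v \<in> X" using u v nonempty(2)[OF dE] nonempty(2)[OF e(1)] by auto
  ultimately obtain es where path: "is_path_hg E es" and uv: "u \<in> \<Union>(set es)" "v \<in> \<Union>(set es)"
    using conn unfolding connected_hg_def by blast
  have esE: "es ! i \<in> E" if "i < length es" for i
    using path nth_mem[OF that] by (auto simp: is_path_hg_def)
  \<comment> \<open>Consecutive edges of a path meet, so if no outside edge touched
    \<open>\<Union>S\<close>, a path could neither enter nor leave \<open>S\<close>.\<close>
  have const: "i < length es \<Longrightarrow> es ! i \<in> S \<longleftrightarrow> es ! 0 \<in> S" for i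
  proof (induction i)
    case (Suc i)
    have "es ! i \<inter> es ! Suc i \<noteq> {}" using path Suc.prems by (simp add: is_path_hg_def)
    then have "es ! i \<in> S \<longleftrightarrow> es ! Suc i \<in> S"
      using sep[of "es ! i"] sep[of "es ! Suc i"] esE[of i] esE[of "Suc i"] Suc.prems by auto
    then show ?case using Suc by simp
  qed simp
  obtain i where i: "i < length es" "u \<in> es ! i" using uv by (auto simp: in_set_conv_nth)
  obtain j where j: "j < length es" "v \<in> es ! j" using uv by (auto simp: in_set_conv_nth)
  have "es ! i \<in> S" using sep[OF esE[OF i(1)]] i u d by blast
  moreover have "es ! j \<notin> S" using j vS by blast
  ultimately show False using const i j by blast
qed

lemma Union_edges_eq:
  assumes H: "hypergraph X E" and conn: "connected_hg X E" and "E \<noteq> {}"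
  shows "\<Union>E = X"
proof
  show "\<Union>E \<subseteq> X" using H by (auto simp: hypergraph_def)
  obtain e where e: "e \<in> E" "e \<subseteq> X" "2 \<le> card e" using H \<open>E \<noteq> {}\<close> by (auto simp: hypergraph_def)
  then have "e \<noteq> {}" by auto
  then obtain u where u: "u \<in> e" by blast
  show "X \<subseteq> \<Union>E"
  proof
    fix v assume v: "v \<in> X"
    show "v \<in> \<Union>E"
    proof (cases "u = v")
      case False
      then obtain es where "is_path_hg E es" "v \<in> \<Union>(set es)"
        using conn u e v unfolding connected_hg_def by blast
      then show ?thesis by (auto simp: is_path_hg_def)
    qed (use u e in blast)
  qed
qed

text \<open>Once \<open>S\<close> contains \<open>C\<close>, a new edge is not in \<open>C\<close>,
  so it attaches at one vertex and contributes the factor N - 1. The family \<open>S\<close> is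
  chosen before \<open>k\<close> and \<open>\<pi>\<close>, so the same growth order serves all
  covers.\<close>

lemma pendant_growth:
  assumes H: "hypergraph X E" and connH: "connected_hg X E" and lin: "linear_hg E"
    and unif: "uniform_hg r E" and r: "2 \<le> r"
    and uniq: "\<And>D l. is_cycle_hg E l D \<Longrightarrow> D = C"
    and C: "C \<subseteq> E" "C \<noteq> {}" "edge_connected C" and n: "n + card C \<le> card E"
  shows "\<exists>S. C \<subseteq> S \<and> S \<subseteq> E \<and> card S = n + card C \<and> edge_connected S \<and>
    (\<forall>k \<pi>. perm_cover k \<pi> \<longrightarrow>
      int (card (pcol k \<pi> (\<Union>S) S)) = int (card (pcol k \<pi> (\<Union>C) C)) * (int k ^ (r - 1) - 1) ^ n)"
  using n
proof (induction n)
  case 0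
  then show ?case using C by auto
next
  case (Suc n)
  have finE: "finite E" and fin: "\<And>d. d \<in> E \<Longrightarrow> finite d"
    using H by (auto simp: hypergraph_def intro: finite_subset[of E "Pow X"] finite_subset[of _ X])
  obtain S where S: "C \<subseteq> S" "S \<subseteq> E" "card S = n + card C" "edge_connected S"
    and count: "\<And>k \<pi>. perm_cover k \<pi> \<Longrightarrow>
      int (card (pcol k \<pi> (\<Union>S) S)) = int (card (pcol k \<pi> (\<Union>C) C)) * (int k ^ (r - 1) - 1) ^ n"
    using Suc by auto
  have "S \<noteq> E" using S(3) Suc.prems by auto
  then obtain e where e: "e \<in> E" "e \<notin> S" "e \<inter> \<Union>S \<noteq> {}"
    using exists_adjacent_edge[OF H connH, of S] S C by blast
  then obtain w where w: "w \<in> e" "w \<in> \<Union>S" by blast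
  have att: "e \<inter> \<Union>S = {w}"
    by (rule unique_attachment[OF lin fin uniq S(2) e(1,2) S(4) _ w]) (use S e in auto)
  have "insert e S \<subseteq> E \<and> card (insert e S) = Suc n + card C"
    using S e finite_subset[OF S(2) finE] by simp
  moreover have "edge_connected (insert e S)" using edge_connected_insert[OF S(4) w] .
  moreover have "int (card (pcol k \<pi> (\<Union>(insert e S)) (insert e S)))
      = int (card (pcol k \<pi> (\<Union>C) C)) * (int k ^ (r - 1) - 1) ^ Suc n" if \<pi>: "perm_cover k \<pi>" for k \<pi>
  proof -
    have finV: "finite (\<Union>S)" using S(2) finE fin by (meson finite_Union finite_subset subsetD)
    have "int (card (pcol k \<pi> (\<Union>S \<union> e) (insert e S))) = int (card (pcol k \<pi> (\<Union>S) S)) * (int k ^ (r - 1) - 1)"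
      by (rule card_pcol_pendant[OF \<pi> finV fin[OF e(1)] _ att _ r])
        (use unif e in \<open>auto simp: uniform_hg_def\<close>)
    moreover have "\<Union>(insert e S) = \<Union>S \<union> e" by auto
    ultimately show ?thesis using count[OF \<pi>] by simp
  qed
  ultimately show ?case using S(1) by (intro exI[of _ "insert e S"]) auto
qed

section \<open>Reduction to permutation covers\<close>

lemma extend_partial_permutation:
  assumes "finite K" "A \<subseteq> K" "inj_on g A" "g ` A \<subseteq> K"
  shows "\<exists>h. bij_betw h K K \<and> (\<forall>a\<in>A. h a = g a)"
proof -
  have "card (K - A) = card (K - g ` A)"
    using assms by (simp add: card_Diff_subset card_image finite_subset)
  then obtain h where h: "bij_betw h (K - A) (K - g ` A)"
    using assms(1) by (meson finite_Diff finite_same_card_bij)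
  have "bij_betw (\<lambda>x. if x \<in> A then g x else h x) (A \<union> (K - A)) (g ` A \<union> (K - g ` A))"
    by (rule bij_betw_disjoint_Un) (use assms(3) h in \<open>auto simp: bij_betw_def\<close>)
  moreover have "A \<union> (K - A) = K" "g ` A \<union> (K - g ` A) = K" using assms by auto
  ultimately show ?thesis by (intro exI[of _ "\<lambda>x. if x \<in> A then g x else h x"]) auto
qed

text \<open>Disjoint maps on a common edge differ at each of its vertices. Hence passing from the
  value at a reference vertex to the value at \<open>x\<close> is a partial injection of the colors,
  and it can be completed to a permutation for each \<open>x\<close> independently.\<close>

lemma cover_extends_to_perm_cover:
  assumes F: "is_cover E k F" and E: "\<And>e. e \<in> E \<Longrightarrow> e \<noteq> {}"
  shows "\<exists>\<pi>. perm_cover k \<pi> \<and> (\<forall>\<phi>\<in>F. \<exists>c\<in>{1..k}. \<forall>x\<in>dom \<phi>. \<phi> x = Some (\<pi> (dom \<phi>) x c))"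
proof -
  let ?K = "{1..k}"
  \<comment> \<open>The maps with domain \<open>e\<close> are indexed by their value at one vertex \<open>x0 e\<close>.\<close>
  define x0 where "x0 e = (SOME x. x \<in> e)" for e :: "'a set"
  have x0: "x0 e \<in> e" if "e \<in> E" for e
    using E[OF that] by (auto simp: x0_def some_in_eq)
  have domF: "dom \<phi> \<in> E" and ranF: "ran \<phi> \<subseteq> ?K" if "\<phi> \<in> F" for \<phi>
    using F that by (auto simp: is_cover_def)
  have disj: "\<phi> = \<psi>" if "\<phi> \<in> F" "\<psi> \<in> F" "dom \<phi> = dom \<psi>" "\<phi> x = Some c" "\<psi> x = Some c" for \<phi> \<psi> x c
  proof (rule ccontr)
    assume "\<phi> \<noteq> \<psi>"
    then have "Map.graph \<phi> \<inter> Map.graph \<psi> = {}" using F that by (simp add: is_cover_def)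
    moreover have "(x, c) \<in> Map.graph \<phi> \<inter> Map.graph \<psi>" using that by (simp add: in_graphI)
    ultimately show False by blast
  qed
  have "\<exists>h. bij_betw h ?K ?K \<and> (\<forall>\<phi>\<in>F. dom \<phi> = e \<longrightarrow> x \<in> e \<longrightarrow> \<phi> x = Some (h (the (\<phi> (x0 e)))))" for e x
  proof (cases "e \<in> E \<and> x \<in> e")
    case True
    let ?Fe = "{\<phi> \<in> F. dom \<phi> = e}"
    define \<iota> where "\<iota> \<phi> = the (\<phi> (x0 e))" for \<phi> :: "'a \<rightharpoonup> nat"
    have val: "\<phi> y = Some (the (\<phi> y))" "the (\<phi> y) \<in> ?K" if "\<phi> \<in> ?Fe" "y \<in> e" for \<phi> y
    proof -
      show "\<phi> y = Some (the (\<phi> y))" using that by auto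
      then show "the (\<phi> y) \<in> ?K" using ranF[of \<phi>] that by (metis (no_types, lifting) mem_Collect_eq ranI subsetD)
    qed
    have inj: "inj_on (\<lambda>\<phi>. the (\<phi> y)) ?Fe" if y: "y \<in> e" for y
    proof (rule inj_onI)
      fix \<phi> \<psi> assume *: "\<phi> \<in> ?Fe" "\<psi> \<in> ?Fe" "the (\<phi> y) = the (\<psi> y)"
      show "\<phi> = \<psi>"
      proof (rule disj)
        show "\<phi> \<in> F" "\<psi> \<in> F" "dom \<phi> = dom \<psi>" using * by auto
        show "\<phi> y = Some (the (\<phi> y))" by (rule val(1)[OF *(1) y])
        show "\<psi> y = Some (the (\<phi> y))" unfolding *(3) by (rule val(1)[OF *(2) y])
      qed
    qed
    have inj\<iota>: "inj_on \<iota> ?Fe" unfolding \<iota>_def using inj x0 True by blast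
    \<comment> \<open>The partial injection: find the map of \<open>F\<close> with reference value
      \<open>c\<close>, then read its value at \<open>x\<close>.\<close>
    define g where "g c = the (inv_into ?Fe \<iota> c x)" for c
    have g\<iota>: "g (\<iota> \<phi>) = the (\<phi> x)" if "\<phi> \<in> ?Fe" for \<phi>
      using inv_into_f_f[OF inj\<iota> that] by (simp add: g_def)
    have "\<exists>h. bij_betw h ?K ?K \<and> (\<forall>c\<in>\<iota> ` ?Fe. h c = g c)"
    proof (rule extend_partial_permutation)
      show "\<iota> ` ?Fe \<subseteq> ?K" using val(2) x0 True unfolding \<iota>_def by blast
      show "inj_on g (\<iota> ` ?Fe)"
      proof (rule inj_onI, elim imageE)
        fix c d \<phi> \<psi>
        assume gc: "g c = g d" and c: "c = \<iota> \<phi>" and d: "d = \<iota> \<psi>" and \<phi>: "\<phi> \<in> ?Fe" and \<psi>: "\<psi> \<in> ?Fe"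
        have "the (\<phi> x) = the (\<psi> x)" using gc unfolding c d g\<iota>[OF \<phi>] g\<iota>[OF \<psi>] .
        then have "\<phi> = \<psi>" using inj_onD[OF inj _ \<phi> \<psi>] True by blast
        then show "c = d" using c d by simp
      qed
      show "g ` \<iota> ` ?Fe \<subseteq> ?K"
      proof (rule image_subsetI, elim imageE)
        fix c \<phi> assume c: "c = \<iota> \<phi>" and \<phi>: "\<phi> \<in> ?Fe"
        show "g c \<in> ?K" unfolding c g\<iota>[OF \<phi>] using val(2)[OF \<phi>] True by blast
      qed
    qed simp
    then obtain h where h: "bij_betw h ?K ?K" "\<And>c. c \<in> \<iota> ` ?Fe \<Longrightarrow> h c = g c" by blast
    have "\<phi> x = Some (h (the (\<phi> (x0 e))))" if "\<phi> \<in> ?Fe" for \<phi>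
      using h(2)[OF imageI[OF that]] g\<iota>[OF that] val(1)[OF that, of x] True by (simp add: \<iota>_def)
    then show ?thesis using h(1) by blast
  next
    \<comment> \<open>No map of \<open>F\<close> constrains this pair; the identity fills the
      place.\<close>
    case False
    then have "\<forall>\<phi>\<in>F. dom \<phi> = e \<longrightarrow> x \<notin> e" using domF by blast
    then show ?thesis using bij_betw_id by blast
  qed
  then obtain \<pi> where \<pi>: "\<And>e x. bij_betw (\<pi> e x) ?K ?K"
    and \<pi>F: "\<And>e x \<phi>. \<phi> \<in> F \<Longrightarrow> dom \<phi> = e \<Longrightarrow> x \<in> e \<Longrightarrow> \<phi> x = Some (\<pi> e x (the (\<phi> (x0 e))))"
    by metis
  have "the (\<phi> (x0 (dom \<phi>))) \<in> ?K" if "\<phi> \<in> F" for \<phi>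
  proof -
    have "x0 (dom \<phi>) \<in> dom \<phi>" using x0 domF[OF that] by blast
    then obtain c where c: "\<phi> (x0 (dom \<phi>)) = Some c" by blast
    then have "c \<in> ran \<phi>" by (rule ranI)
    then show ?thesis using c ranF[OF that] by auto
  qed
  then have "\<forall>\<phi>\<in>F. \<exists>c\<in>?K. \<forall>x\<in>dom \<phi>. \<phi> x = Some (\<pi> (dom \<phi>) x c)"
    using \<pi>F by blast
  moreover have "perm_cover k \<pi>" using \<pi> by (simp add: perm_cover_def)
  ultimately show ?thesis by blast
qed

definition maps_of_perm_cover ::
  "nat \<Rightarrow> ('a set \<Rightarrow> 'a \<Rightarrow> nat \<Rightarrow> nat) \<Rightarrow> 'a set set \<Rightarrow> ('a \<rightharpoonup> nat) set" where
  "maps_of_perm_cover k \<pi> E =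
     {\<lambda>x. if x \<in> e then Some (\<pi> e x c) else None | e c. e \<in> E \<and> c \<in> {1..k}}"

lemma graph_subset_iff:
  assumes "dom \<phi> \<subseteq> X"
  shows "Map.graph \<phi> \<subseteq> (\<lambda>x. (x, f x)) ` X \<longleftrightarrow> (\<forall>x\<in>dom \<phi>. \<phi> x = Some (f x))"
proof (intro iffI ballI subrelI)
  fix x assume sub: "Map.graph \<phi> \<subseteq> (\<lambda>x. (x, f x)) ` X" and "x \<in> dom \<phi>"
  then obtain c where c: "\<phi> x = Some c" by blast
  then have "(x, c) \<in> (\<lambda>x. (x, f x)) ` X" using sub in_graphI by fast
  then show "\<phi> x = Some (f x)" using c by auto
next
  fix x c assume eq: "\<forall>x\<in>dom \<phi>. \<phi> x = Some (f x)" and "(x, c) \<in> Map.graph \<phi>"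
  then have c: "\<phi> x = Some c" by (simp add: in_graphD)
  then have "x \<in> dom \<phi>" by blast
  then show "(x, c) \<in> (\<lambda>x. (x, f x)) ` X" using eq c assms by auto
qed

lemma is_cover_maps_of_perm_cover:
  assumes \<pi>: "perm_cover k \<pi>"
  shows "is_cover E k (maps_of_perm_cover k \<pi> E)"
proof -
  let ?m = "\<lambda>e c x. if x \<in> e then Some (\<pi> e x c) else None"
  have dom: "dom (?m e c) = e" for e c by (auto split: if_splits)
  have ran: "ran (?m e c) \<subseteq> {1..k}" if "c \<in> {1..k}" for e c
    using perm_cover_in[OF \<pi> that] by (auto simp: ran_def split: if_splits)
  have disj: "Map.graph (?m e c) \<inter> Map.graph (?m e d) = {}"
    if "c \<in> {1..k}" "d \<in> {1..k}" "?m e c \<noteq> ?m e d" for e c d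
  proof -
    have "\<pi> e x c \<noteq> \<pi> e x d" for x
      using perm_cover_inj[OF \<pi> that(1,2), of e x] that(3) by blast
    then show ?thesis by (auto simp: Map.graph_def split: if_splits)
  qed
  have elim: "\<exists>e\<in>E. \<exists>c\<in>{1..k}. \<phi> = ?m e c" if "\<phi> \<in> maps_of_perm_cover k \<pi> E" for \<phi>
    using that unfolding maps_of_perm_cover_def by blast
  show ?thesis
    unfolding is_cover_def
  proof (intro conjI ballI impI)
    fix \<phi> assume "\<phi> \<in> maps_of_perm_cover k \<pi> E"
    then obtain e c where "e \<in> E" "c \<in> {1..k}" and \<phi>: "\<phi> = ?m e c" using elim by blast
    then show "dom \<phi> \<in> E" "ran \<phi> \<subseteq> {1..k}" unfolding \<phi> dom using ran by blast+
    fix \<psi> assume "\<psi> \<in> maps_of_perm_cover k \<pi> E" and ne: "\<phi> \<noteq> \<psi>" and eq: "dom \<phi> = dom \<psi>"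
    then obtain e' d where d: "d \<in> {1..k}" and \<psi>: "\<psi> = ?m e' d" using elim by blast
    have "e = e'" using eq unfolding \<phi> \<psi> dom .
    then show "Map.graph \<phi> \<inter> Map.graph \<psi> = {}"
      using disj[OF \<open>c \<in> {1..k}\<close> d, of e'] ne unfolding \<phi> \<psi> \<open>e = e'\<close> by blast
  qed
qed

lemma cover_colorings_maps_of_perm_cover:
  assumes "E \<subseteq> Pow X"
  shows "cover_colorings X k (maps_of_perm_cover k \<pi> E) = pcol k \<pi> X E"
proof -
  let ?m = "\<lambda>e c x. if x \<in> e then Some (\<pi> e x c) else None"
  have dom: "dom (?m e c) = e" for e c by (auto split: if_splits)
  have key: "Map.graph (?m e c) \<subseteq> (\<lambda>x. (x, f x)) ` X \<longleftrightarrow> (\<forall>x\<in>e. f x = \<pi> e x c)" if "e \<in> E" for e c f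
  proof -
    have "dom (?m e c) \<subseteq> X" using dom assms that by auto
    from graph_subset_iff[OF this, of f] show ?thesis by (auto simp: dom)
  qed
  have all: "(\<forall>\<phi>\<in>maps_of_perm_cover k \<pi> E. P \<phi>) \<longleftrightarrow> (\<forall>e\<in>E. \<forall>c\<in>{1..k}. P (?m e c))" for P
    unfolding maps_of_perm_cover_def by blast
  show ?thesis
    unfolding cover_colorings_def pcol_def all by (simp add: key)
qed

lemma pcol_subset_cover_colorings:
  assumes F: "is_cover E k F" and E: "E \<subseteq> Pow X"
    and \<pi>: "\<And>\<phi>. \<phi> \<in> F \<Longrightarrow> \<exists>c\<in>{1..k}. \<forall>x\<in>dom \<phi>. \<phi> x = Some (\<pi> (dom \<phi>) x c)"
  shows "pcol k \<pi> X E \<subseteq> cover_colorings X k F"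
proof
  fix f assume f: "f \<in> pcol k \<pi> X E"
  have "\<not> Map.graph \<phi> \<subseteq> (\<lambda>x. (x, f x)) ` X" if \<phi>: "\<phi> \<in> F" for \<phi>
  proof
    have domE: "dom \<phi> \<in> E" using F \<phi> by (simp add: is_cover_def)
    assume "Map.graph \<phi> \<subseteq> (\<lambda>x. (x, f x)) ` X"
    then have g: "\<forall>x\<in>dom \<phi>. \<phi> x = Some (f x)"
      using graph_subset_iff[of \<phi> X f] E domE by blast
    obtain c where "c \<in> {1..k}" "\<forall>x\<in>dom \<phi>. \<phi> x = Some (\<pi> (dom \<phi>) x c)"
      using \<pi>[OF \<phi>] by blast
    then have "\<exists>c\<in>{1..k}. \<forall>x\<in>dom \<phi>. f x = \<pi> (dom \<phi>) x c" using g by force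
    then show False using f domE unfolding pcol_def by blast
  qed
  then show "f \<in> cover_colorings X k F" using f by (simp add: pcol_def cover_colorings_def)
qed

text \<open>Permutation covers are themselves covers, so the value is attained; any other cover
  extends to one of them, whose colorings are among its own, so nothing smaller occurs.\<close>

lemma DP_count_eqI:
  assumes H: "hypergraph X E" and \<pi>: "perm_cover k \<pi>"
    and min: "\<And>\<pi>'. perm_cover k \<pi>' \<Longrightarrow> card (pcol k \<pi> X E) \<le> card (pcol k \<pi>' X E)"
  shows "DP_count X E k = card (pcol k \<pi> X E)"
  unfolding DP_count_def
proof (rule Min_eqI)
  have finX: "finite X" and EX: "E \<subseteq> Pow X" and ne: "\<And>e. e \<in> E \<Longrightarrow> e \<noteq> {}"
    using H by (auto simp: hypergraph_def)
  show "finite {card (cover_colorings X k F) |F. is_cover E k F}"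
    by (rule finite_cover_counts[OF finX])
  show "card (pcol k \<pi> X E) \<in> {card (cover_colorings X k F) |F. is_cover E k F}"
    by (rule CollectI, rule exI[of _ "maps_of_perm_cover k \<pi> E"])
      (simp add: is_cover_maps_of_perm_cover[OF \<pi>] cover_colorings_maps_of_perm_cover[OF EX])
  fix y assume "y \<in> {card (cover_colorings X k F) |F. is_cover E k F}"
  then obtain F where F: "is_cover E k F" and y: "y = card (cover_colorings X k F)" by blast
  obtain \<pi>' where \<pi>': "perm_cover k \<pi>'"
    and ext: "\<And>\<phi>. \<phi> \<in> F \<Longrightarrow> \<exists>c\<in>{1..k}. \<forall>x\<in>dom \<phi>. \<phi> x = Some (\<pi>' (dom \<phi>) x c)"
    using cover_extends_to_perm_cover[OF F ne] by blast
  have "finite (cover_colorings X k F)"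
    unfolding cover_colorings_def
    by (rule finite_subset[of _ "X \<rightarrow>\<^sub>E {1..k}"]) (use finX in \<open>auto intro: finite_PiE\<close>)
  then have "card (pcol k \<pi>' X E) \<le> y"
    unfolding y using pcol_subset_cover_colorings[OF F EX ext] by (rule card_mono)
  then show "card (pcol k \<pi> X E) \<le> y" using min[OF \<pi>'] by simp
qed

text \<open>With identity permutations the maps of an edge are its constant ones. A constant on an
  edge lies in \<open>{1..k}\<close> because the edge contains a vertex of \<open>X\<close>.\<close>

lemma proper_colorings_eq_pcol:
  assumes H: "hypergraph X E"
  shows "proper_colorings X E k = pcol k (\<lambda>_ _ c. c) X E"
proof -
  have mono: "(\<exists>c. \<forall>x\<in>e. f x = c) \<longleftrightarrow> (\<exists>c\<in>{1..k}. \<forall>x\<in>e. f x = c)" if "e \<in> E" "f \<in> X \<rightarrow>\<^sub>E {1..k}" for e f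
  proof -
    have "e \<noteq> {}" "e \<subseteq> X" using H that(1) by (auto simp: hypergraph_def)
    then obtain x where "x \<in> e" "x \<in> X" by blast
    then have "f x \<in> {1..k}" using \<open>f \<in> X \<rightarrow>\<^sub>E {1..k}\<close> by blast
    then show ?thesis using \<open>x \<in> e\<close> by metis
  qed
  show ?thesis
    unfolding proper_colorings_def pcol_def
    by (intro Collect_cong conj_cong refl ball_cong arg_cong[where f = Not] mono)
qed

text \<open>The even case excludes \<open>k = 1\<close> together with \<open>m = 0\<close>: there N
  - 1 = 0, and the formula reads 0^p - 0^0 = -1, which no count can equal.\<close>

theorem theorem1:
  fixes X :: "'a set" and E :: "'a set set" and p r m k :: nat
  assumes "p \<ge> 3" and "r \<ge> 3" and "k \<ge> 1"
    and "unicyclic_hg X E" and "simple_hg E" and "linear_hg E" and "uniform_hg r E"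
    and "card E = m + p"
    and "\<exists>C. is_cycle_hg E p C"
  shows "(odd p \<longrightarrow> DP_count X E k = chromatic_count X E k) \<and>
    (even p \<longrightarrow> k \<ge> 2 \<or> m \<ge> 1 \<longrightarrow>
      int (DP_count X E k) =
        (int k ^ (r - 1) - 1) ^ (m + p) + (- 1) ^ (p + 1) * (int k ^ (r - 1) - 1) ^ m)"
proof -
  let ?N = "int k ^ (r - 1)"
  have H: "hypergraph X E" and conn: "connected_hg X E"
    and ex1: "\<exists>!C. \<exists>l. is_cycle_hg E l C"
    using assms(4) by (auto simp: unicyclic_hg_def)
  obtain C where cyc: "is_cycle_hg E p C" using assms(9) by blast
  have uniq: "D = C" if "is_cycle_hg E l D" for D l using ex1 cyc that by blast
  have finE: "finite E" and fin: "\<And>d. d \<in> E \<Longrightarrow> finite d"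
    using H by (auto simp: hypergraph_def intro: finite_subset[of E "Pow X"] finite_subset[of _ X])
  have CE: "C \<subseteq> E" and cardC: "card C = p"
    using cyc by (auto simp: is_cycle_hg_def distinct_card)
  have r2: "2 \<le> r" using assms(2) by simp
  obtain S e a b where dec: "loose_path a r (\<Union>S) S b (p - 1)" "C = insert e S" "e \<notin> S"
    "e \<inter> \<Union>S = {a, b}" "a \<noteq> b" "edge_connected C"
    by (rule cycle_decomposition[OF assms(6) fin assms(7) uniq cyc])
  have "C \<noteq> {}" using dec(2) by simp
  have "m + card C \<le> card E" using assms(8) cardC by simp
  obtain T where T: "T \<subseteq> E" "card T = m + card C"
    and growth: "\<And>\<pi>. perm_cover k \<pi> \<Longrightarrow>
      int (card (pcol k \<pi> (\<Union>T) T)) = int (card (pcol k \<pi> (\<Union>C) C)) * (?N - 1) ^ m"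
  proof -
    have "\<exists>S. C \<subseteq> S \<and> S \<subseteq> E \<and> card S = m + card C \<and> edge_connected S \<and>
      (\<forall>k \<pi>. perm_cover k \<pi> \<longrightarrow>
        int (card (pcol k \<pi> (\<Union>S) S)) = int (card (pcol k \<pi> (\<Union>C) C)) * (int k ^ (r - 1) - 1) ^ m)"
      by (rule pendant_growth[OF H conn assms(6,7) r2 uniq CE \<open>C \<noteq> {}\<close> dec(6)]) (assumption, fact)
    then show ?thesis using that by blast
  qed
  have TE: "T = E" using card_subset_eq[OF finE T(1)] T(2) assms(8) cardC by simp
  have EX: "\<Union>E = X" by (rule Union_edges_eq[OF H conn]) (use dec(2) CE in blast)
  \<comment> \<open>The cycle count with \<open>q\<close> agreeing colors, multiplied by one factor
    N - 1 for each of the \<open>m\<close> further edges.\<close>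
  define val where "val q = (?N - 1) ^ (m + p) + (- 1) ^ p * (int q - 1) * (?N - 1) ^ m" for q
  have count: "\<exists>q\<le>k. int (card (pcol k \<pi> X E)) = val q \<and>
      ((\<forall>d\<in>C. \<forall>x\<in>d. \<forall>c\<in>{1..k}. \<pi> d x c = c) \<longrightarrow> q = k) \<and>
      ((\<forall>d\<in>S. \<forall>x\<in>d. \<forall>c\<in>{1..k}. \<pi> d x c = c) \<and> (\<forall>c\<in>{1..k}. \<pi> e a c = c \<and> \<pi> e b c \<noteq> c)
        \<longrightarrow> q = 0)" if \<pi>: "perm_cover k \<pi>" for \<pi>
  proof -
    have e: "finite e" "card e = r" using dec(2) CE fin assms(7) by (auto simp: uniform_hg_def)
    have *: "\<Union>S \<union> e = \<Union>C" "insert e S = C" "Suc (p - 1) = p" using dec(2) assms(1) by auto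
    obtain q where q: "q \<le> k" "int (card (pcol k \<pi> (\<Union>C) C)) = (?N - 1) ^ p + (- 1) ^ p * (int q - 1)"
      "(\<forall>d\<in>C. \<forall>x\<in>d. \<forall>c\<in>{1..k}. \<pi> d x c = c) \<longrightarrow> q = k"
      "(\<forall>d\<in>S. \<forall>x\<in>d. \<forall>c\<in>{1..k}. \<pi> d x c = c) \<and> (\<forall>c\<in>{1..k}. \<pi> e a c = c \<and> \<pi> e b c \<noteq> c)
        \<longrightarrow> q = 0"
      using card_pcol_cycle[OF \<pi> assms(2) dec(1) e dec(4,5), unfolded *] by blast
    have "int (card (pcol k \<pi> X E)) = val q"
      using growth[OF \<pi>] unfolding TE EX q(2) by (simp add: val_def algebra_simps power_add)
    then show ?thesis using q by blast
  qed
  have N: "0 \<le> (?N - 1) ^ m" using assms(3) by simp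
  define \<iota> where "\<iota> = (\<lambda>(_ :: 'a set) (_ :: 'a) (c :: nat). c)"
  have \<iota>: "perm_cover k \<iota>" using bij_betw_id by (simp add: perm_cover_def \<iota>_def id_def)
  have card_\<iota>: "int (card (pcol k \<iota> X E)) = val k"
    using count[OF \<iota>] by (auto simp: \<iota>_def)
  show ?thesis
  proof (intro conjI impI)
    assume odd: "odd p"
    have "DP_count X E k = card (pcol k \<iota> X E)"
    proof (rule DP_count_eqI[OF H \<iota>])
      fix \<pi> :: "'a set \<Rightarrow> 'a \<Rightarrow> nat \<Rightarrow> nat" assume "perm_cover k \<pi>"
      from count[OF this] obtain q where q: "q \<le> k" "int (card (pcol k \<pi> X E)) = val q" by blast
      \<comment> \<open>For odd \<open>p\<close> the value does not increase with \<open>q\<close>,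
        so the largest \<open>q\<close> is the best.\<close>
      have "(1 - int k) * (?N - 1) ^ m \<le> (1 - int q) * (?N - 1) ^ m"
        using q N by (intro mult_right_mono) auto
      then have "val k \<le> val q" using odd by (simp add: val_def)
      then show "card (pcol k \<iota> X E) \<le> card (pcol k \<pi> X E)" using q card_\<iota> by simp
    qed
    then show "DP_count X E k = chromatic_count X E k"
      using proper_colorings_eq_pcol[OF H] by (simp add: chromatic_count_def \<iota>_def)
  next
    assume even: "even p" and km: "k \<ge> 2 \<or> m \<ge> 1"
    obtain \<sigma> where \<sigma>: "perm_cover k \<sigma>" "int (card (pcol k \<sigma> X E)) = val 0"
    proof (cases "k \<ge> 2")
      case True
      \<comment> \<open>The shift sits only at the end \<open>b\<close> of the closing edge; since
        \<open>e \<notin> S\<close> and \<open>a \<noteq> b\<close>, the path and the other end see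
        identities. The shift has no fixed color because \<open>k \<ge> 2\<close>.\<close>
      define \<sigma> where "\<sigma> d x c = (if d = e \<and> x = b then if c = k then 1 else Suc c else c)" for d x c
      have "bij_betw (\<lambda>c. if c = k then 1 else Suc c) {1..k} {1..k}"
        by (rule bij_betw_byWitness[where f' = "\<lambda>c. if c = 1 then k else c - 1"]) (use True in auto)
      moreover have "\<sigma> d x = (if d = e \<and> x = b then \<lambda>c. if c = k then 1 else Suc c else id)" for d x
        by (auto simp: \<sigma>_def)
      ultimately have \<sigma>: "perm_cover k \<sigma>" by (simp only: perm_cover_def bij_betw_id split: if_split) simp
      have "\<forall>d\<in>S. \<forall>x\<in>d. \<forall>c\<in>{1..k}. \<sigma> d x c = c" "\<forall>c\<in>{1..k}. \<sigma> e a c = c \<and> \<sigma> e b c \<noteq> c"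
        using dec(3,5) True by (auto simp: \<sigma>_def)
      then show ?thesis using count[OF \<sigma>] \<sigma> that by blast
    next
      case False
      \<comment> \<open>With one color every permutation has a fixed point, so \<open>q = 0\<close>
        cannot be realized; but N - 1 = 0 and \<open>m \<ge> 1\<close> make \<open>val\<close>
        independent of \<open>q\<close>.\<close>
      then have "k = 1" "m \<ge> 1" using km assms(3) by auto
      then have "val k = val 0" by (simp add: val_def)
      then show ?thesis using that[OF \<iota>] card_\<iota> by simp
    qed
    have "DP_count X E k = card (pcol k \<sigma> X E)"
    proof (rule DP_count_eqI[OF H \<sigma>(1)])
      fix \<pi> :: "'a set \<Rightarrow> 'a \<Rightarrow> nat \<Rightarrow> nat" assume "perm_cover k \<pi>"
      from count[OF this] obtain q where q: "int (card (pcol k \<pi> X E)) = val q" by blast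
      have "(int 0 - 1) * (?N - 1) ^ m \<le> (int q - 1) * (?N - 1) ^ m"
        using N by (intro mult_right_mono) auto
      then have "val 0 \<le> val q" using even by (simp add: val_def)
      then show "card (pcol k \<sigma> X E) \<le> card (pcol k \<pi> X E)" using q \<sigma>(2) by simp
    qed
    then show "int (DP_count X E k) = (?N - 1) ^ (m + p) + (- 1) ^ (p + 1) * (?N - 1) ^ m"
      using \<sigma>(2) even by (simp add: val_def)
  qed
qed

end
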